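(* For $\mu\in\mathcal{G}_1$ with $S$-transform $S_\mu(z)=1+\sum_{n=1}^\infty\beta_nz^n$, let $\theta_\mu:\mathrm{Sym}\to\mathbb{C}$ be the character (unital algebra homomorphism) uniquely determined by the requirement that $\theta_\mu(h_n)=(-1)^n\beta_n$ for all $n\ge1$. Then the map $\mu\mapsto\theta_\mu$ is a group isomorphism from $(\mathcal{G}_1,\boxtimes)$ onto the group $\mathbb{X}(\mathrm{Sym})$ of characters of $\mathrm{Sym}$, endowed with the operation of convolution.
   Context: A non-commutative probability space is a pair $(\mathcal{A},\varphi)$ with $\mathcal{A}$ a unital algebra over $\mathbb{C}$ and $\varphi:\mathcal{A}\to\mathbb{C}$ linear with $\varphi(1_{\mathcal{A}})=1$; the distribution of $a\in\mathcal{A}$ is the linear functional $\mu$ on $\mathbb{C}[X]$ with $\mu(X^n)=\varphi(a^n)$, $n\ge0$. Elements $a,b\in\mathcal{A}$ are freely independent if $\varphi(c_1\cdots c_n)=0$ whenever the $c_j$ come alternatingly from the unital subalgebras generated by $a$ and by $b$ and $\varphi(c_j)=0$ for all $j$. $\boxtimes$ (free multiplicative convolution) is the well-defined operation on linear functionals $\mu$ on $\mathbb{C}[X]$ with $\mu(1)=1$ such that if $a,b$ are freely independent with distributions $\mu,\nu$ then $ab$ has distribution $\mu\boxtimes\nu$. $\mathcal{G}_1$ is the set of linear functionals $\mu:\mathbb{C}[X]\to\mathbb{C}$ with $\mu(1)=1$ and $\mu(X)=1$; it is a group under $\boxtimes$. $S$-transform. For $\mu\in\mathcal{G}_1$ let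 $M_\mu(z)=z+\sum_{n\ge2}\mu(X^n)z^n\in\mathbb{C}[[z]]$ and $S_\mu(z):=\frac{1+z}{z}M_\mu^{\langle-1\rangle}(z)$, where $\langle-1\rangle$ denotes inverse under composition; $S_\mu$ has constant term $1$. $\mathrm{Sym}$ is the Hopf algebra of symmetric functions over $\mathbb{C}$; as an algebra it is the commutative polynomial algebra in the complete homogeneous symmetric functions $h_n$ ($n\ge1$), its comultiplication satisfies $\Delta(h_n)=\sum_{i=0}^nh_i\otimes h_{n-i}$ ($h_0:=1$), and its counit vanishes on homogeneous elements of degree $\ge1$. Convolution of linear functionals on $\mathrm{Sym}$ is $\xi\eta:=(\xi\otimes\eta)\circ\Delta$. $\mathbb{X}(\mathrm{Sym})$ is the set of unital algebra homomorphisms $\mathrm{Sym}\to\mathbb{C}$, a group under convolution. *)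

theory Defs
  imports
    "HOL-Library.Poly_Mapping"
    "HOL-Library.Product_Plus"
    "HOL-Computational_Algebra.Polynomial"
    "HOL-Computational_Algebra.Formal_Power_Series"
    "HOL-Algebra.Group"
begin

section \<open>Non-commutative probability spaces and free independence\<close>

locale complex_algebra = vector_space scale
  for scale :: "complex \<Rightarrow> 'a::ring_1 \<Rightarrow> 'a" +
  assumes scale_mult_left: "scale c x * y = scale c (x * y)"
    and scale_mult_right: "x * scale c y = scale c (x * y)"

locale nc_probability_space = complex_algebra scale
  for scale :: "complex \<Rightarrow> 'a::ring_1 \<Rightarrow> 'a" and \<phi> :: "'a \<Rightarrow> complex" +
  assumes expectation_linear: "Vector_Spaces.linear scale (*) \<phi>"
    and expectation_one: "\<phi> 1 = 1"

definition distribution ::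
    "('a \<Rightarrow> complex) \<Rightarrow> 'a::ring_1 \<Rightarrow> complex poly \<Rightarrow> complex" where
  "distribution \<phi> a p = (\<Sum>i\<le>degree p. coeff p i * \<phi> (a ^ i))"

inductive_set gen_subalgebra :: "(complex \<Rightarrow> 'a::ring_1 \<Rightarrow> 'a) \<Rightarrow> 'a \<Rightarrow> 'a set"
  for scale :: "complex \<Rightarrow> 'a::ring_1 \<Rightarrow> 'a" and a :: 'a where
  gen: "a \<in> gen_subalgebra scale a"
| one: "1 \<in> gen_subalgebra scale a"
| add: "x \<in> gen_subalgebra scale a \<Longrightarrow> y \<in> gen_subalgebra scale a \<Longrightarrow> x + y \<in> gen_subalgebra scale a"
| mult: "x \<in> gen_subalgebra scale a \<Longrightarrow> y \<in> gen_subalgebra scale a \<Longrightarrow> x * y \<in> gen_subalgebra scale a"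
| scale: "x \<in> gen_subalgebra scale a \<Longrightarrow> scale c x \<in> gen_subalgebra scale a"

fun alternating :: "'a set \<Rightarrow> 'a set \<Rightarrow> 'a list \<Rightarrow> bool" where
  "alternating A B [] = True"
| "alternating A B (c # cs) = (c \<in> A \<and> alternating B A cs)"

definition freely_independent ::
    "(complex \<Rightarrow> 'a::ring_1 \<Rightarrow> 'a) \<Rightarrow> ('a \<Rightarrow> complex) \<Rightarrow> 'a \<Rightarrow> 'a \<Rightarrow> bool" where
  "freely_independent scale \<phi> a b \<longleftrightarrow>
     (let A = gen_subalgebra scale a; B = gen_subalgebra scale b in
      \<forall>cs. cs \<noteq> [] \<longrightarrow> alternating A B cs \<or> alternating B A cs \<longrightarrow>
           (\<forall>c\<in>set cs. \<phi> c = 0) \<longrightarrow> \<phi> (prod_list cs) = 0)"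


section \<open>The algebra of a monoid\<close>

definition pm_scale :: "complex \<Rightarrow> ('m \<Rightarrow>\<^sub>0 complex) \<Rightarrow> ('m \<Rightarrow>\<^sub>0 complex)" where
  "pm_scale c f = Poly_Mapping.map ((*) c) f"

definition lin_ext ::
    "(complex \<Rightarrow> 'b \<Rightarrow> 'b) \<Rightarrow> ('m \<Rightarrow> 'b) \<Rightarrow> ('m \<Rightarrow>\<^sub>0 complex) \<Rightarrow> 'b::comm_monoid_add" where
  "lin_ext scale B f = (\<Sum>m\<in>Poly_Mapping.keys f. scale (Poly_Mapping.lookup f m) (B m))"

lemma lookup_pm_scale [simp]:
  "Poly_Mapping.lookup (pm_scale c f) m = c * Poly_Mapping.lookup f m"
  unfolding pm_scale_def by (simp add: Poly_Mapping.map.rep_eq when_def)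

lemma pm_scale_conv_mult:
  "pm_scale c (f :: 'm::monoid_add \<Rightarrow>\<^sub>0 complex) = Poly_Mapping.single 0 c * f"
  unfolding pm_scale_def by (rule mult_map_scale_conv_mult)

lemma pm_scale_single [simp]:
  "pm_scale c (Poly_Mapping.single m d) = Poly_Mapping.single m (c * d)"
  by (rule poly_mapping_eqI) (simp add: lookup_single when_def)

lemma vector_space_pm_scale: "vector_space (pm_scale :: complex \<Rightarrow> ('m \<Rightarrow>\<^sub>0 complex) \<Rightarrow> _)"
  by unfold_locales (auto intro!: poly_mapping_eqI simp: lookup_add algebra_simps)

lemma complex_algebra_pm_scale:
  "complex_algebra (pm_scale :: complex \<Rightarrow> ('m::monoid_add \<Rightarrow>\<^sub>0 complex) \<Rightarrow> _)"
proof -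
  interpret vector_space "pm_scale :: complex \<Rightarrow> ('m \<Rightarrow>\<^sub>0 complex) \<Rightarrow> _"
    by (rule vector_space_pm_scale)
  have expand: "f = (\<Sum>m\<in>Poly_Mapping.keys f. Poly_Mapping.single m (Poly_Mapping.lookup f m))"
    for f :: "'m \<Rightarrow>\<^sub>0 complex"
    by (rule poly_mapping_eqI)
       (auto simp: lookup_sum lookup_single when_def sum.delta in_keys_iff)
  have comm: "f * Poly_Mapping.single 0 c = Poly_Mapping.single 0 c * f"
    for f :: "'m \<Rightarrow>\<^sub>0 complex" and c
  proof -
    define K l where "K = Poly_Mapping.keys f" and "l = Poly_Mapping.lookup f"
    have f: "f = (\<Sum>m\<in>K. Poly_Mapping.single m (l m))"
      unfolding K_def l_def by (rule expand)
    show ?thesis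
      unfolding f by (simp add: sum_distrib_left sum_distrib_right mult_single mult.commute)
  qed
  show ?thesis
  proof
    fix c and x y :: "'m \<Rightarrow>\<^sub>0 complex"
    show "pm_scale c x * y = pm_scale c (x * y)"
      by (simp add: pm_scale_conv_mult mult.assoc)
    show "x * pm_scale c y = pm_scale c (x * y)"
      by (simp add: pm_scale_conv_mult mult.assoc[symmetric] comm)
  qed
qed

lemma pm_expand:
  "f = (\<Sum>m\<in>Poly_Mapping.keys f. pm_scale (Poly_Mapping.lookup f m) (Poly_Mapping.single m 1))"
  by (rule poly_mapping_eqI)
     (auto simp: lookup_sum lookup_single when_def sum.delta in_keys_iff)

lemma linear_lin_ext:
  fixes scale :: "complex \<Rightarrow> 'b::ab_group_add \<Rightarrow> 'b"
  assumes "vector_space scale"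
  shows "Vector_Spaces.linear pm_scale scale (lin_ext scale B)"
proof -
  interpret V: vector_space scale by fact
  interpret P: vector_space "pm_scale :: complex \<Rightarrow> ('a \<Rightarrow>\<^sub>0 complex) \<Rightarrow> _"
    by (rule vector_space_pm_scale)
  show ?thesis
  proof
    fix f g :: "'a \<Rightarrow>\<^sub>0 complex" and c
    show "lin_ext scale B (f + g) = lin_ext scale B f + lin_ext scale B g"
      unfolding lin_ext_def
      by (rule setsum_keys_plus_distrib[where f = "\<lambda>k c. scale c (B k)"])
         (auto simp: V.scale_left_distrib)
    show "lin_ext scale B (pm_scale c f) = scale c (lin_ext scale B f)"
    proof (cases "c = 0")
      case True
      then have "pm_scale c f = 0" by simp
      then show ?thesis using True by (simp add: lin_ext_def)
    next
      case False
      then have "Poly_Mapping.keys (pm_scale c f) = Poly_Mapping.keys f"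
        by (auto simp: in_keys_iff)
      then show ?thesis
        by (simp add: lin_ext_def V.scale_sum_right)
    qed
  qed
qed

lemma lin_ext_single:
  fixes scale :: "complex \<Rightarrow> 'b::ab_group_add \<Rightarrow> 'b"
  assumes "vector_space scale"
  shows "lin_ext scale B (Poly_Mapping.single m c) = scale c (B m)"
proof -
  interpret V: vector_space scale by fact
  show ?thesis by (cases "c = 0") (auto simp: lin_ext_def)
qed

lemma lin_ext_mult:
  fixes scale :: "complex \<Rightarrow> 'b::ring_1 \<Rightarrow> 'b" and B :: "'m::monoid_add \<Rightarrow> 'b"
  assumes "complex_algebra scale" and B: "\<And>m n. B (m + n) = B m * B n"
  shows "lin_ext scale B (f * g) = lin_ext scale B f * lin_ext scale B g"
proof -
  interpret V: complex_algebra scale by fact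
  interpret P: complex_algebra "pm_scale :: complex \<Rightarrow> ('m \<Rightarrow>\<^sub>0 complex) \<Rightarrow> _"
    by (rule complex_algebra_pm_scale)
  interpret L: Vector_Spaces.linear pm_scale scale "lin_ext scale B"
    by (rule linear_lin_ext) (rule V.vector_space_axioms)
  have *: "lin_ext scale B (pm_scale c (Poly_Mapping.single m 1) * pm_scale d (Poly_Mapping.single n 1))
      = scale c (B m) * scale d (B n)" for c d m n
    by (simp add: mult_single lin_ext_single[OF V.vector_space_axioms] B
        V.scale_mult_left V.scale_mult_right mult.commute)
  define K k where "K = Poly_Mapping.keys f" and "k = Poly_Mapping.lookup f"
  define L l where "L = Poly_Mapping.keys g" and "l = Poly_Mapping.lookup g"
  have f: "f = (\<Sum>m\<in>K. pm_scale (k m) (Poly_Mapping.single m 1))"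
    unfolding K_def k_def by (rule pm_expand)
  have g: "g = (\<Sum>n\<in>L. pm_scale (l n) (Poly_Mapping.single n 1))"
    unfolding L_def l_def by (rule pm_expand)
  have "lin_ext scale B (f * g) = (\<Sum>m\<in>K. \<Sum>n\<in>L. scale (k m) (B m) * scale (l n) (B n))"
    unfolding f g by (simp only: sum_product L.sum *)
  then show ?thesis
    by (simp add: lin_ext_def sum_product K_def k_def L_def l_def)
qed


section \<open>Free multiplicative convolution\<close>

datatype letter = LX | LY

datatype word = Word (letters: "letter list")

instantiation word :: monoid_add
begin
definition zero_word :: word where "0 = Word []"
definition plus_word :: "word \<Rightarrow> word \<Rightarrow> word" where "u + v = Word (letters u @ letters v)"
instance by standard (simp_all add: zero_word_def plus_word_def)
end

text \<open>The monoid algebra of the words in two letters is the free algebra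
  \<open>\<complex>\<langle>X,Y\<rangle>\<close>.\<close>

type_synonym free_alg = "word \<Rightarrow>\<^sub>0 complex"

definition gX :: free_alg where "gX = Poly_Mapping.single (Word [LX]) 1"
definition gY :: free_alg where "gY = Poly_Mapping.single (Word [LY]) 1"

definition is_free_product ::
    "(complex poly \<Rightarrow> complex) \<Rightarrow> (complex poly \<Rightarrow> complex) \<Rightarrow> (free_alg \<Rightarrow> complex) \<Rightarrow> bool" where
  "is_free_product \<mu> \<nu> \<phi> \<longleftrightarrow>
     nc_probability_space pm_scale \<phi> \<and> freely_independent pm_scale \<phi> gX gY \<and>
     distribution \<phi> gX = \<mu> \<and> distribution \<phi> gY = \<nu>"

text \<open>
  The distribution of \<open>ab\<close> is computed in the universal model: the free algebra
  \<open>\<complex>\<langle>X,Y\<rangle>\<close> with the functional that makes \<open>X\<close> and \<open>Y\<close> free with distributions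
  \<open>\<mu>\<close> and \<open>\<nu>\<close>. Theorem \<open>distribution_mult_free\<close> below shows that this gives the distribution
  of \<open>ab\<close> in every non-commutative probability space containing a free pair \<open>a\<close>, \<open>b\<close>
  with these distributions.\<close>

definition free_mult_conv ::
    "(complex poly \<Rightarrow> complex) \<Rightarrow> (complex poly \<Rightarrow> complex) \<Rightarrow> complex poly \<Rightarrow> complex"
    (infixl \<open>\<boxtimes>\<close> 70) where
  "\<mu> \<boxtimes> \<nu> = distribution (THE \<phi>. is_free_product \<mu> \<nu> \<phi>) (gX * gY)"

lemma alternating_append:
  "alternating A B (us @ vs) \<longleftrightarrow>
     alternating A B us \<and> (if even (length us) then alternating A B vs else alternating B A vs)"
  by (induction us arbitrary: A B) auto

lemma alternating_if_no_merge:
  assumes "set cs \<subseteq> A \<union> B"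
    and "\<And>us x y vs. cs = us @ x # y # vs \<Longrightarrow> \<not> (x \<in> A \<and> y \<in> A) \<and> \<not> (x \<in> B \<and> y \<in> B)"
  shows "alternating A B cs \<or> alternating B A cs"
  using assms
proof (induction cs)
  case (Cons c cs)
  have IH: "alternating A B cs \<or> alternating B A cs"
  proof (rule Cons.IH)
    show "\<not> (x \<in> A \<and> y \<in> A) \<and> \<not> (x \<in> B \<and> y \<in> B)" if "cs = us @ x # y # vs" for us x y vs
      using Cons.prems(2)[of "c # us"] that by simp
  qed (use Cons.prems(1) in auto)
  show ?case
  proof (cases cs)
    case Nil
    then show ?thesis using Cons.prems(1) by auto
  next
    case (Cons d ds)
    then have "\<not> (c \<in> A \<and> d \<in> A) \<and> \<not> (c \<in> B \<and> d \<in> B)"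
      using Cons.prems(2)[of "[]" c d ds] by simp
    then show ?thesis using IH Cons Cons.prems(1) by auto
  qed
qed simp

lemma alternating_mono:
  "alternating A B cs \<Longrightarrow> A \<subseteq> A' \<Longrightarrow> B \<subseteq> B' \<Longrightarrow> alternating A' B' cs"
  by (induction cs arbitrary: A B A' B') auto

lemma alternating_map:
  "alternating A B cs \<Longrightarrow> alternating (f ` A) (f ` B) (map f cs)"
  by (induction cs arbitrary: A B) auto

lemma freely_independentD:
  assumes "freely_independent scale \<phi> a b" "cs \<noteq> []"
    and "alternating (gen_subalgebra scale a) (gen_subalgebra scale b) cs \<or>
         alternating (gen_subalgebra scale b) (gen_subalgebra scale a) cs"
    and "\<And>c. c \<in> set cs \<Longrightarrow> \<phi> c = 0"
  shows "\<phi> (prod_list cs) = 0"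
  using assms unfolding freely_independent_def Let_def by blast

lemma gen_subalgebra_subset_span:
  assumes "complex_algebra scale"
  shows "gen_subalgebra scale a \<subseteq> module.span scale (range (\<lambda>n. a ^ n))"
proof -
  interpret complex_algebra scale by fact
  let ?S = "span (range (\<lambda>n. a ^ n))"
  have pow: "a ^ n \<in> ?S" for n by (rule span_base) auto
  have pow_mult: "a ^ n * y \<in> ?S" if "y \<in> ?S" for n y
    using that
  proof (induction rule: span_induct_alt)
    case base
    then show ?case by (simp add: span_zero)
  next
    case (step c x y)
    then obtain k where "x = a ^ k" by auto
    then have "a ^ n * (scale c x + y) = scale c (a ^ (n + k)) + a ^ n * y"
      by (simp add: distrib_left scale_mult_right power_add)
    then show ?case using step pow by (simp add: span_add span_scale)
  qed
  have mult: "x * y \<in> ?S" if "x \<in> ?S" "y \<in> ?S" for x y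
    using that(1)
  proof (induction rule: span_induct_alt)
    case base
    then show ?case by (simp add: span_zero)
  next
    case (step c x z)
    then have "scale c x * y \<in> ?S"
      using pow_mult[OF that(2)] by (auto simp: scale_mult_left intro: span_scale)
    then show ?case using step by (simp add: distrib_right span_add)
  qed
  show ?thesis
  proof
    fix x assume "x \<in> gen_subalgebra scale a"
    then show "x \<in> ?S"
    proof induction
      case gen show ?case using pow[of 1] by simp
    next
      case one show ?case using pow[of 0] by simp
    qed (auto intro: span_add span_scale mult)
  qed
qed

lemma distribution_monom: "distribution \<phi> a (Polynomial.monom 1 n) = \<phi> (a ^ n)"
  by (simp add: distribution_def degree_monom_eq sum.delta if_distrib[of "\<lambda>c. c * _"] cong: if_cong)

lemma expectation_eq_on_gen_subalgebra:
  assumes "nc_probability_space scale \<phi>" "nc_probability_space scale \<psi>"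
    and "distribution \<phi> a = distribution \<psi> a" and "x \<in> gen_subalgebra scale a"
  shows "\<phi> x = \<psi> x"
proof -
  interpret N1: nc_probability_space scale \<phi> by fact
  interpret N2: nc_probability_space scale \<psi> by fact
  interpret L1: Vector_Spaces.linear scale "(*)" \<phi> by (rule N1.expectation_linear)
  interpret L2: Vector_Spaces.linear scale "(*)" \<psi> by (rule N2.expectation_linear)
  have pow: "\<phi> (a ^ n) = \<psi> (a ^ n)" for n
    using assms(3) by (metis distribution_monom)
  have "x \<in> N1.span (range (\<lambda>n. a ^ n))"
    using assms(4) gen_subalgebra_subset_span[OF N1.complex_algebra_axioms] by blast
  then show ?thesis
    by (induction rule: N1.span_induct_alt)
       (auto simp: L1.zero L2.zero L1.add L2.add L1.scale L2.scale pow)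
qed

lemma free_expectation_unique:
  fixes scale :: "complex \<Rightarrow> 'a::ring_1 \<Rightarrow> 'a"
  assumes N: "nc_probability_space scale \<phi>" "nc_probability_space scale \<psi>"
    and F: "freely_independent scale \<phi> a b" "freely_independent scale \<psi> a b"
    and D: "distribution \<phi> a = distribution \<psi> a" "distribution \<phi> b = distribution \<psi> b"
    and cs: "set cs \<subseteq> gen_subalgebra scale a \<union> gen_subalgebra scale b"
  shows "\<phi> (prod_list cs) = \<psi> (prod_list cs)"
proof -
  interpret N1: nc_probability_space scale \<phi> by fact
  interpret N2: nc_probability_space scale \<psi> by fact
  interpret L1: Vector_Spaces.linear scale "(*)" \<phi> by (rule N1.expectation_linear)
  interpret L2: Vector_Spaces.linear scale "(*)" \<psi> by (rule N2.expectation_linear)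
  define A where "A = gen_subalgebra scale a"
  define B where "B = gen_subalgebra scale b"
  have eq: "\<phi> x = \<psi> x" if "x \<in> A \<union> B" for x
    using that expectation_eq_on_gen_subalgebra[OF N] D unfolding A_def B_def by blast
  have cent: "x - scale c 1 \<in> S" if "x \<in> S" "S = A \<or> S = B" for x c S
  proof -
    have "x + scale (-c) 1 \<in> S"
      using that unfolding A_def B_def
      by (metis gen_subalgebra.add gen_subalgebra.scale gen_subalgebra.one)
    then show ?thesis by simp
  qed
  have mult: "x * y \<in> S" if "x \<in> S" "y \<in> S" "S = A \<or> S = B" for x y S
    using that gen_subalgebra.mult unfolding A_def B_def by blast
  have "set cs \<subseteq> A \<union> B" using cs by (simp add: A_def B_def)
  then show ?thesis
  proof (induction "length cs" arbitrary: cs rule: less_induct)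
    case less
    show ?case
    proof (cases "\<exists>us x y vs. cs = us @ x # y # vs \<and> ((x \<in> A \<and> y \<in> A) \<or> (x \<in> B \<and> y \<in> B))")
      case True
      then obtain us x y vs where *: "cs = us @ x # y # vs" "(x \<in> A \<and> y \<in> A) \<or> (x \<in> B \<and> y \<in> B)"
        by blast
      then have "x * y \<in> A \<union> B" using mult by blast
      then have "\<phi> (prod_list (us @ (x * y) # vs)) = \<psi> (prod_list (us @ (x * y) # vs))"
        using less.prems * by (intro less.hyps) auto
      then show ?thesis using * by (simp add: mult.assoc)
    next
      case False
      then have alt: "alternating A B cs \<or> alternating B A cs"
        by (intro alternating_if_no_merge less.prems) blast
      have "\<phi> (prod_list (us @ vs)) = \<psi> (prod_list (us @ vs))"
        if "length (us @ vs) = length cs" "alternating A' B' (us @ vs)"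
          "A' = A \<and> B' = B \<or> A' = B \<and> B' = A" "set (us @ vs) \<subseteq> A \<union> B"
          "\<forall>u\<in>set us. \<phi> u = 0" for us vs A' B'
        using that
      proof (induction vs arbitrary: us)
        case Nil
        show ?case
        proof (cases "us = []")
          case True
          then show ?thesis by (simp add: N1.expectation_one N2.expectation_one)
        next
          case False
          have alt: "alternating A B us \<or> alternating B A us" using Nil by auto
          have "\<phi> (prod_list us) = 0"
            using Nil alt False unfolding A_def B_def by (intro freely_independentD[OF F(1)]) auto
          moreover have "\<psi> u = 0" if "u \<in> set us" for u
            using that Nil eq[of u] by auto
          then have "\<psi> (prod_list us) = 0"
            using alt False unfolding A_def B_def by (intro freely_independentD[OF F(2)]) auto
          ultimately show ?thesis by simp
        qed
      next
        case (Cons v vs)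
        define v' where "v' = v - scale (\<phi> v) 1"
        have v: "v = v' + scale (\<phi> v) 1" by (simp add: v'_def)
        define S where "S = (if even (length us) then A' else B')"
        have S: "S = A \<or> S = B" using Cons.prems(3) by (auto simp: S_def)
        have "v \<in> S" using Cons.prems(2) by (auto simp: S_def alternating_append split: if_splits)
        then have v'S: "v' \<in> S" unfolding v'_def using S by (rule cent)
        have cent0: "\<phi> v' = 0" by (simp add: v'_def L1.diff L1.scale N1.expectation_one)
        have "\<phi> (prod_list ((us @ [v']) @ vs)) = \<psi> (prod_list ((us @ [v']) @ vs))"
        proof (rule Cons.IH)
          show "alternating A' B' ((us @ [v']) @ vs)"
            using Cons.prems(2) v'S by (auto simp: S_def alternating_append split: if_splits)
        qed (use Cons.prems v'S S cent0 in auto)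
        moreover have "\<phi> (prod_list (us @ vs)) = \<psi> (prod_list (us @ vs))"
          using Cons.prems by (intro less.hyps) auto
        moreover have "prod_list (us @ v # vs) = prod_list (us @ v' # vs) + scale (\<phi> v) (prod_list (us @ vs))"
          by (subst v) (simp add: algebra_simps N1.scale_mult_left N1.scale_mult_right)
        ultimately show ?case
          by (simp add: L1.add L2.add L1.scale L2.scale)
      qed
      from this[of "[]" cs] alt less.prems show ?thesis by auto
    qed
  qed
qed

lemma prod_list_single_word:
  "Poly_Mapping.single w 1 =
     prod_list (map (\<lambda>l. case l of LX \<Rightarrow> gX | LY \<Rightarrow> gY) (letters w))"
proof -
  have "Poly_Mapping.single (Word ls) 1 =
     prod_list (map (\<lambda>l. case l of LX \<Rightarrow> gX | LY \<Rightarrow> gY) ls)" for ls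
  proof (induction ls)
    case Nil
    then show ?case by (simp flip: zero_word_def)
  next
    case (Cons l ls)
    have "Poly_Mapping.single (Word (l # ls)) (1::complex) =
        Poly_Mapping.single (Word [l]) 1 * Poly_Mapping.single (Word ls) 1"
      by (simp add: mult_single plus_word_def)
    then show ?case by (cases l) (simp_all add: Cons gX_def gY_def)
  qed
  from this[of "letters w"] show ?thesis by simp
qed

lemma is_free_product_unique:
  assumes "is_free_product \<mu> \<nu> \<phi>" "is_free_product \<mu> \<nu> \<psi>"
  shows "\<phi> = \<psi>"
proof
  fix f
  interpret N1: nc_probability_space pm_scale \<phi>
    using assms(1) by (simp add: is_free_product_def)
  interpret N2: nc_probability_space pm_scale \<psi>
    using assms(2) by (simp add: is_free_product_def)
  interpret L1: Vector_Spaces.linear pm_scale "(*)" \<phi> by (rule N1.expectation_linear)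
  interpret L2: Vector_Spaces.linear pm_scale "(*)" \<psi> by (rule N2.expectation_linear)
  have "\<phi> (Poly_Mapping.single w 1) = \<psi> (Poly_Mapping.single w 1)" for w
    unfolding prod_list_single_word using assms
    by (intro free_expectation_unique[of pm_scale \<phi> \<psi> gX gY])
       (auto simp: is_free_product_def gen_subalgebra.gen split: letter.splits)
  then show "\<phi> f = \<psi> f"
    by (subst (1 2) pm_expand[of f]) (simp only: L1.sum L2.sum L1.scale L2.scale)
qed

definition free_alg_eval :: "(complex \<Rightarrow> 'a::ring_1 \<Rightarrow> 'a) \<Rightarrow> 'a \<Rightarrow> 'a \<Rightarrow> free_alg \<Rightarrow> 'a" where
  "free_alg_eval scale a b =
     lin_ext scale (\<lambda>w. prod_list (map (\<lambda>l. case l of LX \<Rightarrow> a | LY \<Rightarrow> b) (letters w)))"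

lemma is_free_product_pullback:
  assumes "nc_probability_space scale \<phi>" and free: "freely_independent scale \<phi> a b"
  shows "is_free_product (distribution \<phi> a) (distribution \<phi> b) (\<phi> \<circ> free_alg_eval scale a b)"
    and "distribution (\<phi> \<circ> free_alg_eval scale a b) (gX * gY) = distribution \<phi> (a * b)"
proof -
  interpret N: nc_probability_space scale \<phi> by fact
  interpret P: complex_algebra "pm_scale :: complex \<Rightarrow> free_alg \<Rightarrow> _"
    by (rule complex_algebra_pm_scale)
  let ?e = "free_alg_eval scale a b"
  interpret E: Vector_Spaces.linear pm_scale scale ?e
    unfolding free_alg_eval_def by (rule linear_lin_ext) (rule N.vector_space_axioms)
  interpret L: Vector_Spaces.linear scale "(*)" \<phi> by (rule N.expectation_linear)
  have e_mult: "?e (f * g) = ?e f * ?e g" for f g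
    unfolding free_alg_eval_def
    by (rule lin_ext_mult[OF N.complex_algebra_axioms]) (simp add: plus_word_def)
  have e_single: "?e (Poly_Mapping.single w 1) =
      prod_list (map (\<lambda>l. case l of LX \<Rightarrow> a | LY \<Rightarrow> b) (letters w))" for w
    unfolding free_alg_eval_def by (simp add: lin_ext_single[OF N.vector_space_axioms])
  have e_one: "?e 1 = 1"
    using e_single[of 0] by (simp add: zero_word_def flip: single_one)
  have e_X: "?e gX = a" and e_Y: "?e gY = b"
    by (simp_all add: gX_def gY_def e_single)
  have e_power: "?e (f ^ n) = ?e f ^ n" for f n
    by (induction n) (simp_all add: e_one e_mult)
  have e_prod: "?e (prod_list cs) = prod_list (map ?e cs)" for cs
    by (induction cs) (simp_all add: e_one e_mult)
  have dist: "distribution (\<phi> \<circ> ?e) f = distribution \<phi> (?e f)" for f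
    by (simp add: fun_eq_iff distribution_def e_power)
  have e_gen: "?e ` gen_subalgebra pm_scale f \<subseteq> gen_subalgebra scale (?e f)" for f
  proof -
    have "?e x \<in> gen_subalgebra scale (?e f)" if "x \<in> gen_subalgebra pm_scale f" for x
      using that
      by induction (auto simp: e_one e_mult E.add E.scale intro: gen_subalgebra.intros)
    then show ?thesis by blast
  qed
  have "nc_probability_space pm_scale (\<phi> \<circ> ?e)"
  proof (intro nc_probability_space.intro nc_probability_space_axioms.intro P.complex_algebra_axioms)
    show "Vector_Spaces.linear pm_scale (*) (\<phi> \<circ> ?e)"
      using E.linear_axioms L.linear_axioms by (rule Vector_Spaces.linear_compose)
    show "(\<phi> \<circ> ?e) 1 = 1" by (simp add: e_one N.expectation_one)
  qed
  moreover have "freely_independent pm_scale (\<phi> \<circ> ?e) gX gY"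
    unfolding freely_independent_def Let_def
  proof (intro allI impI)
    fix cs :: "free_alg list"
    assume ne: "cs \<noteq> []" and 0: "\<forall>c\<in>set cs. (\<phi> \<circ> ?e) c = 0"
      and "alternating (gen_subalgebra pm_scale gX) (gen_subalgebra pm_scale gY) cs \<or>
           alternating (gen_subalgebra pm_scale gY) (gen_subalgebra pm_scale gX) cs"
    then have "alternating (gen_subalgebra scale a) (gen_subalgebra scale b) (map ?e cs) \<or>
           alternating (gen_subalgebra scale b) (gen_subalgebra scale a) (map ?e cs)"
      using e_gen[of gX] e_gen[of gY] unfolding e_X e_Y
      by (blast intro: alternating_mono[OF alternating_map])
    then have "\<phi> (prod_list (map ?e cs)) = 0"
      using ne 0 by (intro freely_independentD[OF free]) auto
    then show "(\<phi> \<circ> ?e) (prod_list cs) = 0" by (simp add: e_prod)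
  qed
  ultimately show "is_free_product (distribution \<phi> a) (distribution \<phi> b) (\<phi> \<circ> ?e)"
    by (simp add: is_free_product_def dist e_X e_Y)
  show "distribution (\<phi> \<circ> ?e) (gX * gY) = distribution \<phi> (a * b)"
    by (simp add: dist e_mult e_X e_Y)
qed

theorem distribution_mult_free:
  assumes "nc_probability_space scale \<phi>" and "freely_independent scale \<phi> a b"
  shows "distribution \<phi> (a * b) = distribution \<phi> a \<boxtimes> distribution \<phi> b"
proof -
  have "(THE \<psi>. is_free_product (distribution \<phi> a) (distribution \<phi> b) \<psi>) =
      \<phi> \<circ> free_alg_eval scale a b"
    using is_free_product_pullback(1)[OF assms] by (blast intro: is_free_product_unique)
  then show ?thesis
    unfolding free_mult_conv_def by (simp add: is_free_product_pullback(2)[OF assms])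
qed


section \<open>The group of normalized distributions and the S-transform\<close>

definition G1 :: "(complex poly \<Rightarrow> complex) set" where
  "G1 = {\<mu>. Vector_Spaces.linear smult (*) \<mu> \<and> \<mu> 1 = 1 \<and> \<mu> [:0, 1:] = 1}"

text \<open>The unit is the distribution of \<open>1\<close>, i.e. \<open>X\<^sup>n \<mapsto> 1\<close> for all \<open>n\<close>.\<close>

definition G1_group :: "(complex poly \<Rightarrow> complex) monoid" where
  "G1_group = \<lparr>carrier = G1, monoid.mult = free_mult_conv, one = (\<lambda>p. poly p 1)\<rparr>"

definition moment_series :: "(complex poly \<Rightarrow> complex) \<Rightarrow> complex fps" where
  "moment_series \<mu> = Abs_fps (\<lambda>n. if n = 0 then 0 else \<mu> ([:0, 1:] ^ n))"

text \<open>\<^const>\<open>fps_inv\<close> is the inverse under composition; the numerator has zero constant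
  term, so the division is exact.\<close>

definition S_transform :: "(complex poly \<Rightarrow> complex) \<Rightarrow> complex fps" where
  "S_transform \<mu> = ((1 + fps_X) * fps_inv (moment_series \<mu>)) / fps_X"


section \<open>The Hopf algebra of symmetric functions\<close>

text \<open>
  \<open>Sym\<close> as the polynomial algebra over \<open>\<complex>\<close> in \<open>h\<^sub>1, h\<^sub>2, \<dots>\<close>: a monomial is an exponent
  vector \<open>nat \<Rightarrow>\<^sub>0 nat\<close>, whose entry at \<open>i\<close> is the exponent of \<open>h\<^sub>i\<^sub>+\<^sub>1\<close>.
  Pairs of monomials form a basis of \<open>Sym \<otimes> Sym\<close>, so the latter is the monoid algebra of
  the product of two copies of the monoid of monomials.\<close>

type_synonym sym_monom = "nat \<Rightarrow>\<^sub>0 nat"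
type_synonym sym = "sym_monom \<Rightarrow>\<^sub>0 complex"
type_synonym sym_tensor = "(sym_monom \<times> sym_monom) \<Rightarrow>\<^sub>0 complex"

fun sym_h :: "nat \<Rightarrow> sym" where
  "sym_h 0 = 1"
| "sym_h (Suc i) = Poly_Mapping.single (Poly_Mapping.single i 1) 1"

definition tensor :: "sym \<Rightarrow> sym \<Rightarrow> sym_tensor" where
  "tensor f g = (\<Sum>m\<in>Poly_Mapping.keys f. \<Sum>n\<in>Poly_Mapping.keys g.
     Poly_Mapping.single (m, n) (Poly_Mapping.lookup f m * Poly_Mapping.lookup g n))"

definition tensor_functional :: "(sym \<Rightarrow> complex) \<Rightarrow> (sym \<Rightarrow> complex) \<Rightarrow> sym_tensor \<Rightarrow> complex" where
  "tensor_functional \<xi> \<eta> =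
     lin_ext (*) (\<lambda>(m, n). \<xi> (Poly_Mapping.single m 1) * \<eta> (Poly_Mapping.single n 1))"

text \<open>The algebra homomorphism that extends \<open>h\<^sub>n \<mapsto> \<Sum>\<^sub>i h\<^sub>i \<otimes> h\<^sub>n\<^sub>-\<^sub>i\<close>.\<close>

definition sym_comult :: "sym \<Rightarrow> sym_tensor" where
  "sym_comult = lin_ext pm_scale (\<lambda>m. \<Prod>i\<in>Poly_Mapping.keys m.
     (\<Sum>j\<le>Suc i. tensor (sym_h j) (sym_h (Suc i - j))) ^ Poly_Mapping.lookup m i)"

definition sym_counit :: "sym \<Rightarrow> complex" where
  "sym_counit f = Poly_Mapping.lookup f 0"

definition sym_convolution :: "(sym \<Rightarrow> complex) \<Rightarrow> (sym \<Rightarrow> complex) \<Rightarrow> sym \<Rightarrow> complex" where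
  "sym_convolution \<xi> \<eta> = tensor_functional \<xi> \<eta> \<circ> sym_comult"

definition sym_characters :: "(sym \<Rightarrow> complex) set" where
  "sym_characters = {\<xi>. Vector_Spaces.linear pm_scale (*) \<xi> \<and> \<xi> 1 = 1 \<and>
     (\<forall>f g. \<xi> (f * g) = \<xi> f * \<xi> g)}"

definition sym_character_group :: "(sym \<Rightarrow> complex) monoid" where
  "sym_character_group =
     \<lparr>carrier = sym_characters, monoid.mult = sym_convolution, one = sym_counit\<rparr>"

lemma vector_space_complex: "vector_space ((*) :: complex \<Rightarrow> complex \<Rightarrow> complex)"
  by unfold_locales (auto simp: algebra_simps)

lemma tensor_functional_tensor:
  assumes "Vector_Spaces.linear pm_scale (*) \<xi>" "Vector_Spaces.linear pm_scale (*) \<eta>"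
  shows "tensor_functional \<xi> \<eta> (tensor f g) = \<xi> f * \<eta> g"
proof -
  interpret X: Vector_Spaces.linear pm_scale "(*)" \<xi> by fact
  interpret E: Vector_Spaces.linear pm_scale "(*)" \<eta> by fact
  interpret T: Vector_Spaces.linear pm_scale "(*)" "tensor_functional \<xi> \<eta>"
    unfolding tensor_functional_def by (rule linear_lin_ext) (rule vector_space_complex)
  have ev: "\<zeta> f = (\<Sum>m\<in>Poly_Mapping.keys f. Poly_Mapping.lookup f m * \<zeta> (Poly_Mapping.single m 1))"
    if "Vector_Spaces.linear pm_scale (*) \<zeta>" for \<zeta> :: "sym \<Rightarrow> complex" and f
  proof -
    interpret Z: Vector_Spaces.linear pm_scale "(*)" \<zeta> by fact
    show ?thesis by (subst pm_expand[of f]) (simp only: Z.sum Z.scale)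
  qed
  have s: "tensor_functional \<xi> \<eta> (Poly_Mapping.single (m, n) c) =
      c * (\<xi> (Poly_Mapping.single m 1) * \<eta> (Poly_Mapping.single n 1))" for m n c
    unfolding tensor_functional_def by (simp add: lin_ext_single[OF vector_space_complex])
  have "tensor_functional \<xi> \<eta> (tensor f g) =
      (\<Sum>m\<in>Poly_Mapping.keys f. \<Sum>n\<in>Poly_Mapping.keys g.
        (Poly_Mapping.lookup f m * Poly_Mapping.lookup g n) *
        (\<xi> (Poly_Mapping.single m 1) * \<eta> (Poly_Mapping.single n 1)))"
    by (simp only: tensor_def T.sum s)
  also have "\<dots> = (\<Sum>m\<in>Poly_Mapping.keys f. Poly_Mapping.lookup f m * \<xi> (Poly_Mapping.single m 1)) *
      (\<Sum>n\<in>Poly_Mapping.keys g. Poly_Mapping.lookup g n * \<eta> (Poly_Mapping.single n 1))"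
    by (simp only: sum_product mult_ac)
  also have "\<dots> = \<xi> f * \<eta> g"
    by (simp only: ev[OF assms(1), of f, symmetric] ev[OF assms(2), of g, symmetric])
  finally show ?thesis .
qed

lemma sym_comult_linear: "Vector_Spaces.linear pm_scale pm_scale sym_comult"
  unfolding sym_comult_def by (rule linear_lin_ext) (rule vector_space_pm_scale)

lemma sym_comult_mult: "sym_comult (f * g) = sym_comult f * sym_comult g"
  unfolding sym_comult_def
proof (rule lin_ext_mult[OF complex_algebra_pm_scale])
  fix m n :: sym_monom
  define c where "c i = (\<Sum>j\<le>Suc i. tensor (sym_h j) (sym_h (Suc i - j)))" for i
  let ?K = "Poly_Mapping.keys m \<union> Poly_Mapping.keys n"
  have ext: "(\<Prod>i\<in>Poly_Mapping.keys k. c i ^ Poly_Mapping.lookup k i) =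
      (\<Prod>i\<in>?K. c i ^ Poly_Mapping.lookup k i)"
    if "Poly_Mapping.keys k \<subseteq> ?K" for k
    using that by (intro prod.mono_neutral_left) (auto simp: in_keys_iff)
  have "(\<Prod>i\<in>Poly_Mapping.keys (m + n). c i ^ Poly_Mapping.lookup (m + n) i) =
      (\<Prod>i\<in>Poly_Mapping.keys m. c i ^ Poly_Mapping.lookup m i) *
      (\<Prod>i\<in>Poly_Mapping.keys n. c i ^ Poly_Mapping.lookup n i)"
    unfolding ext[of m, OF Un_upper1] ext[of n, OF Un_upper2] ext[OF Poly_Mapping.keys_add]
    by (simp add: lookup_add power_add prod.distrib)
  then show "(\<Prod>i\<in>Poly_Mapping.keys (m + n).
        (\<Sum>j\<le>Suc i. tensor (sym_h j) (sym_h (Suc i - j))) ^ Poly_Mapping.lookup (m + n) i) =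
      (\<Prod>i\<in>Poly_Mapping.keys m.
        (\<Sum>j\<le>Suc i. tensor (sym_h j) (sym_h (Suc i - j))) ^ Poly_Mapping.lookup m i) *
      (\<Prod>i\<in>Poly_Mapping.keys n.
        (\<Sum>j\<le>Suc i. tensor (sym_h j) (sym_h (Suc i - j))) ^ Poly_Mapping.lookup n i)"
    unfolding c_def .
qed

lemma sym_comult_one: "sym_comult 1 = 1"
  unfolding sym_comult_def
  by (subst single_one[symmetric], subst lin_ext_single[OF vector_space_pm_scale])
     (simp add: pm_scale_conv_mult)

lemma sym_comult_h: "sym_comult (sym_h n) = (\<Sum>i\<le>n. tensor (sym_h i) (sym_h (n - i)))"
proof (cases n)
  case 0
  have "tensor 1 1 = 1" by (simp add: tensor_def flip: zero_prod_def)
  then show ?thesis using 0 by (simp add: sym_comult_one)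
next
  case (Suc i)
  then show ?thesis
    unfolding sym_comult_def
    by (simp add: lin_ext_single[OF vector_space_pm_scale] del: sum.atMost_Suc
        vector_space.vector_space_assms(4)[OF vector_space_pm_scale])
       (simp add: vector_space.vector_space_assms(4)[OF vector_space_pm_scale] del: sum.atMost_Suc)
qed


section \<open>The map from distributions to characters\<close>

definition theta :: "(complex poly \<Rightarrow> complex) \<Rightarrow> sym \<Rightarrow> complex" where
  "theta \<mu> = (THE \<theta>. \<theta> \<in> sym_characters \<and>
     (\<forall>n\<ge>1. \<theta> (sym_h n) = (-1) ^ n * fps_nth (S_transform \<mu>) n))"

end

theory Submission
  imports Defs
begin

text \<open>
  Both groups are isomorphic to the multiplicative group of power series with constant term
  \<open>1\<close>: distributions through the S-transform, and characters through the generating series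
  \<open>\<Sum>\<^sub>n (-1)\<^sup>n \<xi>(h\<^sub>n) z\<^sup>n\<close>. By definition \<open>\<theta>\<^sub>\<mu>\<close> is the character whose generating series is
  \<open>S\<^sub>\<mu>\<close>, so the map in question is a composite of isomorphisms, and both group structures are
  obtained by transport (\<open>group_from_iso\<close>).

  On the side of characters this is formal: \<open>Sym\<close> is a polynomial algebra in the \<open>h\<^sub>n\<close>, so a
  character is an arbitrary choice of the values \<open>\<xi>(h\<^sub>n)\<close>, and the comultiplication turns
  convolution into the Cauchy product of the sequences of values.

  The content lies in \<open>S\<^sub>\<mu>\<^sub>\<boxtimes>\<^sub>\<nu> = S\<^sub>\<mu> S\<^sub>\<nu>\<close> (\<open>S_transform_free_mult_conv\<close>). Since \<open>\<mu> \<boxtimes> \<nu>\<close> is the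
  distribution of \<open>ab\<close> for any free pair with distributions \<open>\<mu>\<close> and \<open>\<nu>\<close>, it suffices to exhibit
  one convenient pair. The model is Haagerup's, in transposed form. Let the space consist of all
  functions of words in two letters. For a letter \<open>l\<close> let \<open>L\<close> be the operator that moves the
  value at \<open>w\<close> to \<open>l w\<close>, and \<open>L\<^sup>*\<close> the one with \<open>(L\<^sup>* v)(w) = v(l w)\<close>, and put
  \<open>a\<^sub>l = f(L) (1 + L\<^sup>*)\<close> for a power series \<open>f\<close> with constant
  term \<open>1\<close>. Working with all functions, instead of the finitely
  supported ones, is what makes \<open>f(L)\<close> meaningful for a formal power series. Three facts finish
  the argument.

  First, operators belonging to different letters are free in the vacuum state
  \<open>T \<mapsto> (T \<Omega>)([])\<close> (\<open>local_at_freely_independent\<close>), because an operator of the letter \<open>l\<close> acts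
  only on the power of \<open>l\<close> with which a word begins.

  Second, pairing with the formal vector
  \<open>\<sigma> = (1 - z (L\<^sub>X + L\<^sub>Y + L\<^sub>Y L\<^sub>X))\<^sup>-\<^sup>1 \<Omega>\<close> gives a functional \<open>\<Psi>\<close> with values in power series that
  satisfies \<open>z \<Psi>(a b v) = f g ((1 + z) \<Psi>(v) - v([]))\<close> for \<open>a = f(L\<^sub>X)(1 + L\<^sub>X\<^sup>*)\<close> and
  \<open>b = g(L\<^sub>Y)(1 + L\<^sub>Y\<^sup>*)\<close>
  (\<open>tile_series_haagerup_product\<close>). Iterating this relation from \<open>v = \<Omega>\<close> gives
  \<open>\<Sum>\<^sub>n \<phi>((a b)\<^sup>n) u\<^sup>n = 1 + z\<close> with \<open>u = z / ((1 + z) f g)\<close>, which says that the S-transform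
  of \<open>a b\<close> is \<open>1 / (f g)\<close>.

  Third, the case in which one of the two series is \<open>1\<close> shows that the S-transforms of \<open>a\<close> and
  \<open>b\<close> are \<open>1 / f\<close> and \<open>1 / g\<close>. So every series with constant term \<open>1\<close> is the S-transform of such an
  operator of either letter, and the S-transform of \<open>a b\<close> is the product of theirs.\<close>


section \<open>Linear operators on functions of words\<close>

text \<open>Free independence is formulated for elements of a type of class \<open>ring_1\<close>; the type of linear
  operators supplies such elements, with composition as multiplication.\<close>

typedef fock_op = "{T :: (letter list \<Rightarrow> complex) \<Rightarrow> letter list \<Rightarrow> complex.
    \<forall>u v c w. T (\<lambda>w. u w + c * v w) w = T u w + c * T v w}"
  morphisms act Fock_op
  by (rule exI[of _ "\<lambda>v w. 0"]) auto

setup_lifting type_definition_fock_op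

lemma act_linear: "act T (\<lambda>w. u w + c * v w) w = act T u w + c * act T v w"
  using act[of T] by blast

lemma act_add: "act T (\<lambda>w. u w + v w) w = act T u w + act T v w"
  using act_linear[of T u 1 v w] by simp

lemma act_zero: "act T (\<lambda>w. 0) w = 0"
  using act_linear[of T "\<lambda>w. 0" 1 "\<lambda>w. 0" w] by simp

lemma act_scale: "act T (\<lambda>w. c * v w) w = c * act T v w"
  using act_linear[of T "\<lambda>w. 0" c v w] by (simp add: act_zero)

instantiation fock_op :: ring_1
begin
lift_definition zero_fock_op :: fock_op is "\<lambda>v w. 0" by simp
lift_definition one_fock_op :: fock_op is "\<lambda>v w. v w" by simp
lift_definition plus_fock_op :: "fock_op \<Rightarrow> fock_op \<Rightarrow> fock_op" is "\<lambda>S T v w. S v w + T v w"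
  by (simp add: algebra_simps)
lift_definition uminus_fock_op :: "fock_op \<Rightarrow> fock_op" is "\<lambda>T v w. - T v w"
  by (simp add: algebra_simps)
lift_definition minus_fock_op :: "fock_op \<Rightarrow> fock_op \<Rightarrow> fock_op" is "\<lambda>S T v w. S v w - T v w"
  by (simp add: algebra_simps)
lift_definition times_fock_op :: "fock_op \<Rightarrow> fock_op \<Rightarrow> fock_op" is "\<lambda>S T v. S (T v)"
  subgoal premises lin for S T
  proof -
    have "T (\<lambda>w. u w + c * v w) = (\<lambda>w. T u w + c * T v w)" for u v c
      using lin(2) by auto
    then show ?thesis using lin(1) by simp
  qed
  done
instance
proof
  fix a b c :: fock_op
  show "a * b * c = a * (b * c)" "1 * a = a" "a * 1 = a" "(a + b) * c = a * c + b * c"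
      "a + b + c = a + (b + c)" "a + b = b + a" "0 + a = a" "- a + a = 0" "a - b = a + - b"
    by (simp_all add: act_inject[symmetric] fun_eq_iff zero_fock_op.rep_eq one_fock_op.rep_eq
        plus_fock_op.rep_eq minus_fock_op.rep_eq uminus_fock_op.rep_eq times_fock_op.rep_eq)
  show "a * (b + c) = a * b + a * c"
    by (simp add: act_inject[symmetric] fun_eq_iff times_fock_op.rep_eq plus_fock_op.rep_eq act_add)
  show "(0::fock_op) \<noteq> 1"
    by transfer (metis zero_neq_one)
qed
end

lift_definition fock_scale :: "complex \<Rightarrow> fock_op \<Rightarrow> fock_op" is "\<lambda>c T v w. c * T v w"
  by (simp add: algebra_simps)

lemmas fock_op_rep_eqs = zero_fock_op.rep_eq one_fock_op.rep_eq plus_fock_op.rep_eq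
  minus_fock_op.rep_eq uminus_fock_op.rep_eq times_fock_op.rep_eq fock_scale.rep_eq

definition vacuum :: "letter list \<Rightarrow> complex" where
  "vacuum w = (if w = [] then 1 else 0)"

definition vacuum_state :: "fock_op \<Rightarrow> complex" where
  "vacuum_state T = act T vacuum []"

lemma fock_algebra: "complex_algebra fock_scale"
  by (intro complex_algebra.intro complex_algebra_axioms.intro, unfold_locales)
     (auto simp: act_inject[symmetric] fun_eq_iff fock_op_rep_eqs act_scale algebra_simps)

lemma fock_probability_space: "nc_probability_space fock_scale vacuum_state"
proof (intro nc_probability_space.intro nc_probability_space_axioms.intro fock_algebra)
  interpret F: complex_algebra fock_scale by (rule fock_algebra)
  interpret C: vector_space "(*) :: complex \<Rightarrow> complex \<Rightarrow> complex" by (rule vector_space_complex)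
  show "Vector_Spaces.linear fock_scale (*) vacuum_state"
    by unfold_locales (simp_all add: vacuum_state_def fock_op_rep_eqs)
  show "vacuum_state 1 = 1"
    by (simp add: vacuum_state_def vacuum_def fock_op_rep_eqs)
qed


section \<open>Freeness in the vacuum state\<close>

text \<open>An operator is local at \<open>l\<close> if it acts, for each word \<open>w\<close> that does not begin with
  \<open>l\<close>, on the sequence \<open>j \<mapsto> v (l\<^sup>j w)\<close>, and acts there by the same rule for all
  \<open>w\<close>. Saying this through proportional sequences, instead of naming the rule, builds in
  homogeneity and makes closure under products immediate.\<close>

definition local_at :: "letter \<Rightarrow> fock_op \<Rightarrow> bool" where
  "local_at l T \<longleftrightarrow> (\<forall>c v v' w w'.
     (\<forall>u. w \<noteq> l # u) \<longrightarrow> (\<forall>u. w' \<noteq> l # u) \<longrightarrow>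
     (\<forall>j. v (replicate j l @ w) = c * v' (replicate j l @ w')) \<longrightarrow>
     (\<forall>k. act T v (replicate k l @ w) = c * act T v' (replicate k l @ w')))"

lemma local_atD:
  assumes "local_at l T" "\<And>u. w \<noteq> l # u" "\<And>u. w' \<noteq> l # u"
    and "\<And>j. v (replicate j l @ w) = c * v' (replicate j l @ w')"
  shows "act T v (replicate k l @ w) = c * act T v' (replicate k l @ w')"
  using assms unfolding local_at_def by blast

text \<open>Elements of the algebra generated by \<open>a\<close> inherit locality; freeness is a statement about
  all of them.\<close>

lemma local_at_gen_subalgebra:
  assumes "local_at l a" "x \<in> gen_subalgebra fock_scale a"
  shows "local_at l x"
  using assms(2)
proof induction
  case gen
  show ?case by (rule assms(1))
next
  case one
  show ?case by (simp add: local_at_def fock_op_rep_eqs)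
next
  case (add x y)
  show ?case
    unfolding local_at_def fock_op_rep_eqs
    by (intro allI impI, simp only: distrib_left)
       (intro arg_cong2[where f = "(+)"] local_atD[OF add.IH(1)] local_atD[OF add.IH(2)]; simp)
next
  case (mult x y)
  show ?case
    unfolding local_at_def fock_op_rep_eqs
    by (intro allI impI local_atD[OF mult.IH(1)] local_atD[OF mult.IH(2)]) auto
next
  case (scale x c)
  show ?case
    unfolding local_at_def fock_op_rep_eqs
    by (intro allI impI, simp only: mult.left_commute[of _ c])
       (intro arg_cong2[where f = "(*)"] refl local_atD[OF scale.IH]; simp)
qed

text \<open>On the sequence \<open>j \<mapsto> v (l\<^sup>j w)\<close>, which equals \<open>v w\<close> times the vacuum, the operator acts as
  it does on the vacuum, so its value at \<open>j = 0\<close> is a multiple of the vanishing expectation.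
  Hence a centred operator moves the support of \<open>v\<close> onto the words that begin with \<open>l\<close>.\<close>

lemma local_at_centred:
  assumes "local_at l T" "vacuum_state T = 0"
    and v: "\<And>u. v (l # u) = 0" and w: "\<And>u. w \<noteq> l # u"
  shows "act T v w = 0"
proof -
  have "act T v (replicate 0 l @ w) = v w * act T vacuum (replicate 0 l @ [])"
  proof (rule local_atD[OF assms(1) w])
    show "v (replicate j l @ w) = v w * vacuum (replicate j l @ [])" for j
      by (cases j) (simp_all add: vacuum_def v)
  qed simp
  with assms(2) show ?thesis by (simp add: vacuum_state_def)
qed

text \<open>Read from right to left, each factor moves the support of the vector onto the words beginning
  with its own letter, where the next factor, of the other letter, finds a vector to which
  \<open>local_at_centred\<close> applies. At the end the empty word is outside the support, which says that the
  expectation vanishes.\<close>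

lemma alternating_centred_product:
  assumes "l \<noteq> l'" "cs \<noteq> []" "alternating A B cs"
    and "\<And>x. x \<in> A \<Longrightarrow> local_at l x" "\<And>x. x \<in> B \<Longrightarrow> local_at l' x"
    and "\<And>c. c \<in> set cs \<Longrightarrow> vacuum_state c = 0" and "\<And>u. w \<noteq> l # u"
  shows "act (prod_list cs) vacuum w = 0"
  using assms
proof (induction cs arbitrary: l l' A B w)
  case (Cons c cs)
  have "act c (act (prod_list cs) vacuum) w = 0"
  proof (rule local_at_centred[of l])
    show "act (prod_list cs) vacuum (l # u) = 0" for u
    proof (cases "cs = []")
      case True
      then show ?thesis by (simp add: fock_op_rep_eqs vacuum_def)
    next
      case False
      then show ?thesis
        using Cons.prems by (intro Cons.IH[of l' l B A]) auto
    qed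
  qed (use Cons.prems in auto)
  then show ?case by (simp add: fock_op_rep_eqs)
qed simp

lemma local_at_freely_independent:
  assumes "l \<noteq> l'" "local_at l a" "local_at l' b"
  shows "freely_independent fock_scale vacuum_state a b"
  unfolding freely_independent_def Let_def
proof (intro allI impI)
  fix cs
  let ?A = "gen_subalgebra fock_scale a" and ?B = "gen_subalgebra fock_scale b"
  assume cs: "cs \<noteq> []" "alternating ?A ?B cs \<or> alternating ?B ?A cs" "\<forall>c\<in>set cs. vacuum_state c = 0"
  from cs(2) have "act (prod_list cs) vacuum [] = 0"
  proof
    assume "alternating ?A ?B cs"
    then show ?thesis
      using assms cs local_at_gen_subalgebra
      by (intro alternating_centred_product[of l l' cs ?A ?B]) auto
  next
    assume "alternating ?B ?A cs"
    then show ?thesis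
      using assms cs local_at_gen_subalgebra
      by (intro alternating_centred_product[of l' l cs ?B ?A]) auto
  qed
  then show "vacuum_state (prod_list cs) = 0" by (simp add: vacuum_state_def)
qed


section \<open>The operators with prescribed S-transform\<close>

text \<open>The power series \<open>f\<close> in the operator that maps \<open>v\<close> to \<open>w \<mapsto> v (w')\<close> if
  \<open>w = l w'\<close> and to \<open>0\<close> otherwise. At each word only finitely many powers contribute, so no
  convergence is at stake.\<close>

primrec prepend_series ::
    "letter \<Rightarrow> complex fps \<Rightarrow> (letter list \<Rightarrow> complex) \<Rightarrow> letter list \<Rightarrow> complex" where
  "prepend_series l f v [] = fps_nth f 0 * v []"
| "prepend_series l f v (x # w) = fps_nth f 0 * v (x # w) +
     (if x = l then prepend_series l (fps_shift 1 f) v w else 0)"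

lemma prepend_series_linear:
  "prepend_series l f (\<lambda>w. u w + c * v w) w = prepend_series l f u w + c * prepend_series l f v w"
  by (induction w arbitrary: f) (auto simp: algebra_simps)

lemma prepend_series_0: "prepend_series l 0 v w = 0"
  by (induction w) auto

lemma prepend_series_1: "prepend_series l 1 v w = v w"
proof -
  have "fps_shift 1 (1 :: complex fps) = 0" by (simp add: fps_eq_iff)
  then show ?thesis by (cases w) (simp_all add: prepend_series_0)
qed

text \<open>The operator \<open>f(L) (1 + L\<^sup>*)\<close> of the letter \<open>l\<close>, the transpose of Haagerup's
  \<open>(1 + L) f(L\<^sup>*)\<close>.\<close>

lift_definition haagerup_op :: "letter \<Rightarrow> complex fps \<Rightarrow> fock_op"
  is "\<lambda>l f v. prepend_series l f (\<lambda>w. v w + v (l # w))"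
  subgoal for l f u v c w
  proof -
    have "(\<lambda>w. u w + c * v w + (u (l # w) + c * v (l # w))) =
        (\<lambda>w. (u w + u (l # w)) + c * (v w + v (l # w)))"
      by (simp add: algebra_simps)
    then show "prepend_series l f (\<lambda>w. u w + c * v w + (u (l # w) + c * v (l # w))) w =
        prepend_series l f (\<lambda>w. u w + u (l # w)) w + c * prepend_series l f (\<lambda>w. v w + v (l # w)) w"
      by (simp only: prepend_series_linear)
  qed
  done

lemma local_at_haagerup_op: "local_at l (haagerup_op l f)"
  unfolding local_at_def
proof (intro allI impI)
  fix c w w' k and v v' :: "letter list \<Rightarrow> complex"
  assume w: "\<forall>u. w \<noteq> l # u" and w': "\<forall>u. w' \<noteq> l # u"
    and v: "\<forall>j. v (replicate j l @ w) = c * v' (replicate j l @ w')"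
  have bare: "prepend_series l f x w = fps_nth f 0 * x w" if "\<forall>u. w \<noteq> l # u" for f x w
    using that by (cases w) auto
  have "prepend_series l f (\<lambda>w. v w + v (l # w)) (replicate k l @ w) =
      c * prepend_series l f (\<lambda>w. v' w + v' (l # w)) (replicate k l @ w')"
  proof (induction k arbitrary: f)
    case 0
    then show ?case
      using v[rule_format, of 0] v[rule_format, of 1] by (simp add: bare[OF w] bare[OF w'] algebra_simps)
  next
    case (Suc k)
    then show ?case
      using v[rule_format, of "Suc k"] v[rule_format, of "Suc (Suc k)"] by (simp add: algebra_simps)
  qed
  then show "act (haagerup_op l f) v (replicate k l @ w) =
      c * act (haagerup_op l f) v' (replicate k l @ w')"
    by (simp add: haagerup_op.rep_eq)
qed


section \<open>Moments of the product\<close>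

text \<open>The sum of \<open>v (t\<^sub>1 \<dots> t\<^sub>n)\<close> over all choices of \<open>n\<close> tiles \<open>t\<^sub>i\<close> among the words \<open>X\<close>, \<open>Y\<close> and
  \<open>YX\<close>. The generating series in \<open>n\<close> is the pairing of \<open>v\<close> with
  \<open>\<sigma> = (1 - z (L\<^sub>X + L\<^sub>Y + L\<^sub>Y L\<^sub>X))\<^sup>-\<^sup>1 \<Omega>\<close>. The tile \<open>YX\<close> makes \<open>\<sigma>\<close> compatible with the product of the
  operators of \<open>X\<close> and \<open>Y\<close>, in this order: \<open>1 + L\<^sub>X + L\<^sub>Y + L\<^sub>Y L\<^sub>X = (1 + L\<^sub>Y) (1 + L\<^sub>X)\<close>.\<close>

primrec tile_coeff :: "nat \<Rightarrow> (letter list \<Rightarrow> complex) \<Rightarrow> complex" where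
  "tile_coeff 0 v = v []"
| "tile_coeff (Suc n) v = tile_coeff n (\<lambda>w. v (LX # w)) + tile_coeff n (\<lambda>w. v (LY # w)) +
     tile_coeff n (\<lambda>w. v (LY # LX # w))"

definition tile_series :: "(letter list \<Rightarrow> complex) \<Rightarrow> complex fps" where
  "tile_series v = Abs_fps (\<lambda>n. tile_coeff n v)"

lemma tile_series_linear:
  "tile_series (\<lambda>w. u w + c * v w) = tile_series u + fps_const c * tile_series v"
proof -
  have "tile_coeff n (\<lambda>w. u w + c * v w) = tile_coeff n u + c * tile_coeff n v" for n
    by (induction n arbitrary: u v) (simp_all add: algebra_simps)
  then show ?thesis by (simp add: tile_series_def fps_eq_iff)
qed

lemma tile_series_rec:
  "tile_series v = fps_const (v []) + fps_X * (tile_series (\<lambda>w. v (LX # w)) +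
     tile_series (\<lambda>w. v (LY # w)) + tile_series (\<lambda>w. v (LY # LX # w)))"
proof (rule fps_ext)
  show "fps_nth (tile_series v) n = fps_nth (fps_const (v []) + fps_X * (tile_series (\<lambda>w. v (LX # w)) +
     tile_series (\<lambda>w. v (LY # w)) + tile_series (\<lambda>w. v (LY # LX # w)))) n" for n
    by (cases n) (simp_all add: tile_series_def)
qed

lemma tile_series_vacuum: "tile_series vacuum = 1"
proof -
  have 0: "tile_coeff n (\<lambda>w. 0) = 0" for n by (induction n) auto
  have "tile_coeff n vacuum = (if n = 0 then 1 else 0)" for n
    by (cases n) (simp_all add: vacuum_def 0)
  then show ?thesis by (simp add: tile_series_def fps_eq_iff)
qed

text \<open>A functional that turns the prepending operator into multiplication by the formal
  variable turns a power series in that operator into multiplication by this series.\<close>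

lemma prepend_series_eigenfunctional:
  fixes \<Psi> :: "(letter list \<Rightarrow> complex) \<Rightarrow> complex fps"
  assumes lin: "\<And>u v c. \<Psi> (\<lambda>w. u w + c * v w) = \<Psi> u + fps_const c * \<Psi> v"
    and eig: "\<And>v. \<Psi> (\<lambda>w. case w of [] \<Rightarrow> 0 | x # w' \<Rightarrow> if x = l then v w' else 0) = fps_X * \<Psi> v"
  shows "\<Psi> (prepend_series l f v) = f * \<Psi> v"
proof (rule fps_ext)
  fix n
  show "fps_nth (\<Psi> (prepend_series l f v)) n = fps_nth (f * \<Psi> v) n"
  proof (induction n arbitrary: f rule: less_induct)
    case (less n)
    let ?f = "fps_shift 1 f"
    have 0: "prepend_series l f v = (\<lambda>w. (case w of [] \<Rightarrow> 0 | x # w' \<Rightarrow>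
        if x = l then prepend_series l ?f v w' else 0) + fps_nth f 0 * v w)"
      by (rule ext) (simp split: list.split)
    have 1: "\<Psi> (prepend_series l f v) = fps_X * \<Psi> (prepend_series l ?f v) + fps_const (fps_nth f 0) * \<Psi> v"
      by (subst 0) (simp only: lin eig)
    have f: "f = fps_const (fps_nth f 0) + fps_X * ?f"
      by (rule fps_ext) (simp add: fps_X_mult_nth)
    have 2: "f * \<Psi> v = fps_X * (?f * \<Psi> v) + fps_const (fps_nth f 0) * \<Psi> v"
      by (subst f) (simp add: algebra_simps)
    show ?case
      unfolding 1 2 using less by (cases n) (simp_all add: fps_X_mult_nth)
  qed
qed

text \<open>The pairing with \<open>\<sigma>\<close> is an eigenfunctional for \<open>L\<^sub>X\<close>: only the tile \<open>X\<close> begins with \<open>X\<close>.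
  It is not one for \<open>L\<^sub>Y\<close>, but its composite with \<open>1 + L\<^sub>X\<^sup>*\<close> is, since a word of tiles that begins
  with \<open>Y\<close> continues, after this letter, with a word of tiles or with such a word preceded by \<open>X\<close>.
  So the two series \<open>f\<close> and \<open>g\<close> can be pulled out one after the other, and the
  remaining \<open>(1 + L\<^sub>X\<^sup>*) (1 + L\<^sub>Y\<^sup>*)\<close> is undone by the recursion for \<open>\<sigma>\<close>.\<close>

lemma tile_series_haagerup_product:
  "fps_X * tile_series (act (haagerup_op LX f * haagerup_op LY g) v) =
     f * g * ((1 + fps_X) * tile_series v - fps_const (v []))"
proof -
  define \<Psi> where "\<Psi> v = tile_series (\<lambda>w. v w + v (LX # w))" for v :: "letter list \<Rightarrow> complex"
  have add: "tile_series (\<lambda>w. u w + v w) = tile_series u + tile_series v" for u v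
    using tile_series_linear[of u 1 v] by simp
  have zero: "tile_series (\<lambda>w. 0) = 0"
    using tile_series_linear[of "\<lambda>w. 0" "1" "\<lambda>w. 0"] by simp
  have X: "tile_series (prepend_series LX f v) = f * tile_series v" for f v
  proof (rule prepend_series_eigenfunctional[OF tile_series_linear])
    show "tile_series (\<lambda>w. case w of [] \<Rightarrow> 0 | x # w' \<Rightarrow> if x = LX then v w' else 0) =
        fps_X * tile_series v" for v
      by (subst tile_series_rec) (simp add: zero)
  qed
  have Y: "\<Psi> (prepend_series LY g v) = g * \<Psi> v" for g v
  proof (rule prepend_series_eigenfunctional)
    show "\<Psi> (\<lambda>w. u w + c * v w) = \<Psi> u + fps_const c * \<Psi> v" for u v c
      unfolding \<Psi>_def tile_series_linear[symmetric] by (simp add: algebra_simps)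
    show "\<Psi> (\<lambda>w. case w of [] \<Rightarrow> 0 | x # w' \<Rightarrow> if x = LY then v w' else 0) = fps_X * \<Psi> v" for v
      unfolding \<Psi>_def by (subst tile_series_rec) (simp add: zero add)
  qed
  have "tile_series (act (haagerup_op LX f * haagerup_op LY g) v) =
      f * (g * \<Psi> (\<lambda>w. v w + v (LY # w)))"
  proof -
    have "tile_series (act (haagerup_op LX f * haagerup_op LY g) v) =
        f * \<Psi> (prepend_series LY g (\<lambda>w. v w + v (LY # w)))"
      by (simp add: fock_op_rep_eqs haagerup_op.rep_eq X \<Psi>_def)
    then show ?thesis by (simp only: Y)
  qed
  moreover have "fps_X * \<Psi> (\<lambda>w. v w + v (LY # w)) = (1 + fps_X) * tile_series v - fps_const (v [])"
    using tile_series_rec[of v] by (simp add: \<Psi>_def add algebra_simps)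
  ultimately show ?thesis by (simp add: mult.left_commute mult.assoc)
qed

definition moments :: "fock_op \<Rightarrow> complex fps" where
  "moments T = Abs_fps (\<lambda>n. vacuum_state (T ^ n))"

text \<open>The relation \<open>z \<Psi>(T v) = f g ((1 + z) \<Psi>(v) - v([]))\<close> expresses \<open>\<Psi>(v)\<close> through \<open>v([])\<close> and
  \<open>u \<Psi>(T v)\<close>. Iterated from the vacuum, it collects the moments of \<open>T\<close> as coefficients of the powers
  of \<open>u\<close>; the remainder is divisible by a high power of \<open>u\<close>, hence of \<open>z\<close>.\<close>

lemma moments_haagerup_product:
  assumes "fps_nth f 0 \<noteq> 0" "fps_nth g 0 \<noteq> 0"
  shows "moments (haagerup_op LX f * haagerup_op LY g) oo
    (fps_X * inverse (f * g) * inverse (1 + fps_X)) = 1 + fps_X"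
proof -
  define T where "T = haagerup_op LX f * haagerup_op LY g"
  define u where "u = fps_X * inverse (f * g) * inverse (1 + fps_X)"
  define h :: "complex fps" where "h = inverse (1 + fps_X)"
  have h: "h * (1 + fps_X) = 1" unfolding h_def by (rule inverse_mult_eq_1) simp
  have fg: "inverse (f * g) * (f * g) = 1" by (rule inverse_mult_eq_1) (simp add: assms)
  have step: "tile_series v = h * fps_const (v []) + u * tile_series (act T v)" for v
  proof -
    have "u * tile_series (act T v) = inverse (f * g) * h * (fps_X * tile_series (act T v))"
      by (simp add: u_def h_def mult_ac)
    also have "\<dots> = (inverse (f * g) * (f * g)) * (h * (1 + fps_X) * tile_series v - h * fps_const (v []))"
      unfolding T_def tile_series_haagerup_product by (simp add: algebra_simps)
    finally show ?thesis by (simp add: fg h)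
  qed
  have expand: "1 = h * (\<Sum>k<n. fps_const (vacuum_state (T ^ k)) * u ^ k) +
      u ^ n * tile_series (act (T ^ n) vacuum)" for n
  proof (induction n)
    case 0
    then show ?case by (simp add: fock_op_rep_eqs tile_series_vacuum)
  next
    case (Suc n)
    have "tile_series (act (T ^ n) vacuum) =
        h * fps_const (vacuum_state (T ^ n)) + u * tile_series (act (T ^ Suc n) vacuum)"
      by (subst step) (simp add: vacuum_state_def fock_op_rep_eqs)
    with Suc show ?case by (simp add: algebra_simps)
  qed
  have u0: "fps_nth u 0 = 0" by (simp add: u_def)
  have "fps_nth (moments T oo u) n = fps_nth (1 + fps_X) n" for n
  proof -
    have eq: "1 + fps_X = (\<Sum>k<Suc n. fps_const (vacuum_state (T ^ k)) * u ^ k) +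
        (1 + fps_X) * (u ^ Suc n * tile_series (act (T ^ Suc n) vacuum))"
    proof -
      have alg: "p * (q * s + r) = (q * p) * s + p * r" for p q r s :: "complex fps"
        by (simp add: algebra_simps)
      have "(1 + fps_X) * 1 = (1 + fps_X) * (h * (\<Sum>k<Suc n. fps_const (vacuum_state (T ^ k)) * u ^ k) +
          u ^ Suc n * tile_series (act (T ^ Suc n) vacuum))"
        by (rule arg_cong[OF expand, of "(*) (1 + fps_X)"])
      also have "\<dots> = (h * (1 + fps_X)) * (\<Sum>k<Suc n. fps_const (vacuum_state (T ^ k)) * u ^ k) +
          (1 + fps_X) * (u ^ Suc n * tile_series (act (T ^ Suc n) vacuum))"
        by (rule alg)
      finally show ?thesis by (simp only: h mult_1 mult_1_right)
    qed
    \<comment> \<open>\<open>n + 1\<close> steps of the iteration suffice for the coefficient of \<open>z\<^sup>n\<close>, as \<open>u\<close> has no constant term.\<close>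
    have rest: "fps_nth ((1 + fps_X) * (u ^ Suc n * tile_series (act (T ^ Suc n) vacuum))) n = 0"
    proof -
      have "fps_nth (u ^ Suc n * x) n = 0" "fps_nth (fps_X * (u ^ Suc n * x)) n = 0" for x
        using startsby_zero_power_prefix[OF u0]
        by (auto simp: fps_mult_nth fps_X_mult_nth simp del: power_Suc)
      then show ?thesis by (simp add: distrib_right del: power_Suc)
    qed
    have "fps_nth (1 + fps_X) n = fps_nth (\<Sum>k<Suc n. fps_const (vacuum_state (T ^ k)) * u ^ k) n"
      using arg_cong[OF eq, of "\<lambda>f. fps_nth f n"] rest by (simp only: fps_add_nth add_0_right)
    then show ?thesis
      by (simp add: fps_compose_nth moments_def fps_sum_nth atLeast0AtMost lessThan_Suc_atMost del: sum.lessThan_Suc)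
  qed
  then show ?thesis unfolding T_def u_def by (rule fps_ext)
qed

lemma haagerup_op_letter_support:
  assumes "\<And>w. \<not> set w \<subseteq> {l} \<Longrightarrow> v w = 0"
  shows "\<not> set w \<subseteq> {l} \<Longrightarrow> act (haagerup_op l f) v w = 0"
    and "l' \<noteq> l \<Longrightarrow> act (haagerup_op l' 1) v = v"
proof -
  have "prepend_series l f v w = 0" if "\<not> set w \<subseteq> {l}" "\<And>w. \<not> set w \<subseteq> {l} \<Longrightarrow> v w = 0" for v
    using that(1)
  proof (induction w arbitrary: f)
    case (Cons x w)
    then show ?case using that(2)[of "x # w"] by auto
  qed simp
  from this[of "\<lambda>w. v w + v (l # w)"] show "\<not> set w \<subseteq> {l} \<Longrightarrow> act (haagerup_op l f) v w = 0"
    using assms by (simp add: haagerup_op.rep_eq)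
  show "l' \<noteq> l \<Longrightarrow> act (haagerup_op l' 1) v = v"
    using assms by (simp add: haagerup_op.rep_eq fun_eq_iff prepend_series_1)
qed

text \<open>On vectors supported on the powers of a single letter the operator of the other letter
  with series \<open>1\<close> is the identity, so the moments of one operator are moments of a product.\<close>

lemma moments_haagerup:
  assumes "fps_nth f 0 \<noteq> 0"
  shows "moments (haagerup_op l f) oo (fps_X * inverse f * inverse (1 + fps_X)) = 1 + fps_X"
proof -
  have supp: "act (haagerup_op l f ^ n) vacuum w = 0" if "\<not> set w \<subseteq> {l}" for n w
    using that
  proof (induction n arbitrary: w)
    case 0
    then show ?case by (auto simp: fock_op_rep_eqs vacuum_def)
  next
    case (Suc n)
    then show ?case by (simp add: fock_op_rep_eqs haagerup_op_letter_support(1))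
  qed
  have other: "act (haagerup_op l' 1) (act (haagerup_op l f ^ n) vacuum) = act (haagerup_op l f ^ n) vacuum"
    if "l' \<noteq> l" for l' n
    using supp that by (rule haagerup_op_letter_support(2))
  have power: "act (haagerup_op l f ^ Suc n) vacuum = act (haagerup_op l f) (act (haagerup_op l f ^ n) vacuum)" for n
    by (simp add: fock_op_rep_eqs)
  show ?thesis
  proof (cases l)
    case LX
    have "act ((haagerup_op LX f * haagerup_op LY 1) ^ n) vacuum = act (haagerup_op LX f ^ n) vacuum" for n
      using other[of LY] LX by (induction n) (simp_all add: fock_op_rep_eqs)
    then have "moments (haagerup_op LX f * haagerup_op LY 1) = moments (haagerup_op LX f)"
      by (simp add: moments_def vacuum_state_def)
    then show ?thesis using moments_haagerup_product[of f 1] LX assms by simp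
  next
    case LY
    have "act ((haagerup_op LX 1 * haagerup_op LY f) ^ n) vacuum = act (haagerup_op LY f ^ n) vacuum" for n
    proof (induction n)
      case (Suc n)
      then show ?case
        using other[of LX "Suc n"] power[of n] LY by (simp add: fock_op_rep_eqs)
    qed simp
    then have "moments (haagerup_op LX 1 * haagerup_op LY f) = moments (haagerup_op LY f)"
      by (simp add: moments_def vacuum_state_def)
    then show ?thesis using moments_haagerup_product[of 1 f] LY assms by simp
  qed
qed


section \<open>The S-transform as an isomorphism onto power series\<close>

lemma linear_functional_moments:
  assumes "Vector_Spaces.linear smult (*) (\<mu> :: complex poly \<Rightarrow> complex)"
  shows "\<mu> p = (\<Sum>i\<le>degree p. coeff p i * \<mu> ([:0, 1:] ^ i))"
proof -
  interpret L: Vector_Spaces.linear smult "(*)" \<mu> by fact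
  have "\<mu> p = \<mu> (\<Sum>i\<le>degree p. smult (coeff p i) ([:0, 1:] ^ i))"
    by (simp add: poly_as_sum_of_monoms flip: monom_altdef)
  then show ?thesis by (simp only: L.sum L.scale)
qed

lemma distribution_linear: "Vector_Spaces.linear smult (*) (distribution \<phi> a)"
proof -
  have ext: "distribution \<phi> a p = (\<Sum>i\<le>n. coeff p i * \<phi> (a ^ i))" if "degree p \<le> n" for p n
    unfolding distribution_def using that
    by (intro sum.mono_neutral_left) (auto simp: coeff_eq_0)
  interpret P: vector_space "smult :: complex \<Rightarrow> complex poly \<Rightarrow> _"
    by unfold_locales (simp_all add: smult_add_right smult_add_left)
  interpret C: vector_space "(*) :: complex \<Rightarrow> complex \<Rightarrow> complex" by (rule vector_space_complex)
  show ?thesis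
  proof
    fix p q :: "complex poly" and c
    define n where "n = max (degree p) (degree q)"
    have "degree p \<le> n" "degree q \<le> n" "degree (p + q) \<le> n"
      by (simp_all add: n_def degree_add_le_max)
    then show "distribution \<phi> a (p + q) = distribution \<phi> a p + distribution \<phi> a q"
      by (simp add: ext[of _ n] sum.distrib distrib_right)
    show "distribution \<phi> a (smult c p) = c * distribution \<phi> a p"
      using ext[of "smult c p" "degree p"] ext[of p "degree p"]
      by (simp add: degree_smult_le sum_distrib_left del: degree_smult_eq)
  qed
qed

lemma G1_moment_series_inj:
  assumes "\<mu> \<in> G1" "\<nu> \<in> G1" "moment_series \<mu> = moment_series \<nu>"
  shows "\<mu> = \<nu>"
proof
  fix p
  have "\<mu> ([:0, 1:] ^ i) = \<nu> ([:0, 1:] ^ i)" for i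
    using assms by (cases i) (auto simp: moment_series_def G1_def fps_eq_iff split: if_splits)
  moreover have "Vector_Spaces.linear smult (*) \<mu>" "Vector_Spaces.linear smult (*) \<nu>"
    using assms by (simp_all add: G1_def)
  ultimately show "\<mu> p = \<nu> p"
    by (simp only: linear_functional_moments[of \<mu> p] linear_functional_moments[of \<nu> p])
qed

text \<open>This form avoids both the compositional inverse and the division by \<open>z\<close> of the definition, and
  matches the moment identities of the model.\<close>

lemma S_transform_eq_iff:
  assumes "\<mu> \<in> G1"
  shows "S_transform \<mu> = s \<longleftrightarrow> moment_series \<mu> oo (fps_X * s * inverse (1 + fps_X)) = fps_X"
proof -
  define M where "M = moment_series \<mu>"
  define I where "I = fps_inv M"
  define u where "u = fps_X * s * inverse (1 + fps_X)"
  have M0: "fps_nth M 0 = 0" and M1: "fps_nth M 1 = 1" and u0: "fps_nth u 0 = 0"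
    using assms by (simp_all add: M_def moment_series_def G1_def u_def)
  have I0: "fps_nth I 0 = 0" by (simp add: I_def fps_inv_def)
  have inv: "I oo M = fps_X" "M oo I = fps_X"
    unfolding I_def using fps_inv[OF M0] fps_inv_right[OF M0] M1 by simp_all
  have h: "inverse (1 + fps_X) * (1 + fps_X) = (1 :: complex fps)" by (rule inverse_mult_eq_1) simp
  have S: "fps_X * S_transform \<mu> = (1 + fps_X) * I"
  proof (rule fps_ext)
    show "fps_nth (fps_X * S_transform \<mu>) n = fps_nth ((1 + fps_X) * I) n" for n
      by (cases n) (simp_all add: S_transform_def I_def[symmetric] M_def[symmetric] I0)
  qed
  have "S_transform \<mu> = s \<longleftrightarrow> fps_X * s = (1 + fps_X) * I"
    by (auto simp flip: S)
  also have "\<dots> \<longleftrightarrow> u = I"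
  proof
    assume "fps_X * s = (1 + fps_X) * I"
    then have "u = (1 + fps_X) * I * inverse (1 + fps_X)" by (simp only: u_def)
    also have "\<dots> = (inverse (1 + fps_X) * (1 + fps_X)) * I" by (simp only: mult_ac)
    finally show "u = I" by (simp only: h mult_1)
  next
    assume "u = I"
    then have "(1 + fps_X) * I = (1 + fps_X) * (fps_X * s * inverse (1 + fps_X))" by (simp only: u_def)
    also have "\<dots> = (inverse (1 + fps_X) * (1 + fps_X)) * (fps_X * s)" by (simp only: mult_ac)
    finally show "fps_X * s = (1 + fps_X) * I" by (simp only: h mult_1)
  qed
  also have "\<dots> \<longleftrightarrow> M oo u = fps_X"
  proof
    assume "M oo u = fps_X"
    then have "I = I oo (M oo u)" by simp
    also have "\<dots> = u" by (simp add: fps_compose_assoc u0 M0 inv)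
    finally show "u = I" ..
  qed (simp add: inv)
  finally show ?thesis by (simp add: M_def u_def)
qed

lemma S_transform_0:
  assumes "\<mu> \<in> G1"
  shows "fps_nth (S_transform \<mu>) 0 = 1"
proof -
  define u where "u = fps_X * S_transform \<mu> * inverse (1 + fps_X)"
  have "fps_nth (moment_series \<mu> oo u) 1 = 1"
    using S_transform_eq_iff[OF assms, of "S_transform \<mu>"] by (simp add: u_def)
  moreover have "fps_nth u 1 = fps_nth (S_transform \<mu>) 0"
    by (simp add: u_def mult.assoc)
  ultimately show ?thesis
    using assms by (simp add: fps_compose_nth moment_series_def G1_def)
qed

lemma S_transform_inj: "inj_on S_transform G1"
proof
  fix \<mu> \<nu> assume G: "\<mu> \<in> G1" "\<nu> \<in> G1" and S: "S_transform \<mu> = S_transform \<nu>"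
  let ?u = "fps_X * S_transform \<mu> * inverse (1 + fps_X)"
  have "moment_series \<mu> oo ?u = moment_series \<nu> oo ?u"
    using S_transform_eq_iff[OF G(1), of "S_transform \<mu>"] S_transform_eq_iff[OF G(2), of "S_transform \<mu>"] S
    by simp
  moreover have "fps_nth ?u 0 = 0" "fps_nth ?u 1 \<noteq> 0"
    using S_transform_0[OF G(1)] by (simp_all add: mult.assoc)
  ultimately show "\<mu> = \<nu>"
    using G by (intro G1_moment_series_inj) (simp_all add: fps_compose_inj_right)
qed

lemma S_transform_distribution:
  assumes "moments T oo (fps_X * s * inverse (1 + fps_X)) = 1 + fps_X" and "fps_nth s 0 = 1"
  shows "distribution vacuum_state T \<in> G1" "S_transform (distribution vacuum_state T) = s"
proof -
  define u where "u = fps_X * s * inverse (1 + fps_X)"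
  have u1: "fps_nth u 1 = 1" by (simp add: u_def mult.assoc assms(2))
  have mom: "distribution vacuum_state T ([:0, 1:] ^ n) = fps_nth (moments T) n" for n
    using distribution_monom[of vacuum_state T n] by (simp add: moments_def monom_altdef)
  have m0: "fps_nth (moments T) 0 = 1"
    using fps_compose_nth_0[of "moments T" u] assms(1) by (simp add: u_def)
  have "fps_nth (moments T oo u) 1 = 1" using assms(1) by (simp add: u_def)
  then have m1: "fps_nth (moments T) 1 = 1" using u1 by (simp add: fps_compose_nth)
  show G: "distribution vacuum_state T \<in> G1"
    using mom[of 0] mom[of 1] m0 m1 by (simp add: G1_def distribution_linear)
  have "moment_series (distribution vacuum_state T) = moments T - 1"
    by (rule fps_ext) (simp add: moment_series_def mom m0)
  then have "moment_series (distribution vacuum_state T) oo u = fps_X"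
    using assms(1) by (simp add: fps_compose_sub_distrib u_def)
  then show "S_transform (distribution vacuum_state T) = s"
    by (simp add: S_transform_eq_iff[OF G] u_def)
qed

text \<open>Every series with constant term \<open>1\<close> is an S-transform; injectivity then lets any prescribed
  distribution be realised by an operator of either letter.\<close>

lemma haagerup_op_S_transform:
  assumes "fps_nth s 0 = 1"
  shows "distribution vacuum_state (haagerup_op l (inverse s)) \<in> G1"
    "S_transform (distribution vacuum_state (haagerup_op l (inverse s))) = s"
proof -
  have "moments (haagerup_op l (inverse s)) oo (fps_X * s * inverse (1 + fps_X)) = 1 + fps_X"
  proof -
    have "inverse (inverse s) = s" "fps_nth (inverse s) 0 \<noteq> 0"
      using assms by (simp_all add: fps_inverse_idempotent)
    then show ?thesis using moments_haagerup[of "inverse s" l] by (simp only: not_False_eq_True)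
  qed
  from S_transform_distribution[OF this assms]
  show "distribution vacuum_state (haagerup_op l (inverse s)) \<in> G1"
    "S_transform (distribution vacuum_state (haagerup_op l (inverse s))) = s" .
qed

lemma S_transform_free_mult_conv:
  assumes "\<mu> \<in> G1" "\<nu> \<in> G1"
  shows "\<mu> \<boxtimes> \<nu> \<in> G1" "S_transform (\<mu> \<boxtimes> \<nu>) = S_transform \<mu> * S_transform \<nu>"
proof -
  define A where "A = haagerup_op LX (inverse (S_transform \<mu>))"
  define B where "B = haagerup_op LY (inverse (S_transform \<nu>))"
  have "distribution vacuum_state A = \<mu>"
    unfolding A_def using assms haagerup_op_S_transform[OF S_transform_0]
    by (intro inj_onD[OF S_transform_inj]) auto
  moreover have "distribution vacuum_state B = \<nu>"
    unfolding B_def using assms haagerup_op_S_transform[OF S_transform_0]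
    by (intro inj_onD[OF S_transform_inj]) auto
  moreover have "freely_independent fock_scale vacuum_state A B"
    unfolding A_def B_def by (rule local_at_freely_independent[OF _ local_at_haagerup_op local_at_haagerup_op]) simp
  ultimately have conv: "distribution vacuum_state (A * B) = \<mu> \<boxtimes> \<nu>"
    using distribution_mult_free[OF fock_probability_space] by metis
  have "moments (A * B) oo (fps_X * (S_transform \<mu> * S_transform \<nu>) * inverse (1 + fps_X)) = 1 + fps_X"
  proof -
    have "inverse (inverse (S_transform \<mu>) * inverse (S_transform \<nu>)) = S_transform \<mu> * S_transform \<nu>"
        "fps_nth (inverse (S_transform \<mu>)) 0 \<noteq> 0" "fps_nth (inverse (S_transform \<nu>)) 0 \<noteq> 0"
      using assms by (simp_all add: S_transform_0 fps_inverse_mult fps_inverse_idempotent)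
    then show ?thesis
      unfolding A_def B_def
      using moments_haagerup_product[of "inverse (S_transform \<mu>)" "inverse (S_transform \<nu>)"] by metis
  qed
  from S_transform_distribution[OF this]
  show "\<mu> \<boxtimes> \<nu> \<in> G1" "S_transform (\<mu> \<boxtimes> \<nu>) = S_transform \<mu> * S_transform \<nu>"
    by (simp_all add: conv S_transform_0 assms)
qed

text \<open>The operator with series \<open>1\<close> fixes the vacuum, so all its moments are \<open>1\<close>.\<close>

lemma S_transform_one: "(\<lambda>p. poly p 1) \<in> G1" "S_transform (\<lambda>p. poly p 1) = 1"
proof -
  have "act (haagerup_op LX 1) vacuum = vacuum"
    by (simp add: haagerup_op.rep_eq prepend_series_1 fun_eq_iff vacuum_def)
  then have "act (haagerup_op LX 1 ^ n) vacuum = vacuum" for n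
    by (induction n) (simp_all add: fock_op_rep_eqs)
  then have "distribution vacuum_state (haagerup_op LX 1) = (\<lambda>p. poly p 1)"
    by (simp add: fun_eq_iff distribution_def poly_altdef vacuum_state_def vacuum_def)
  with haagerup_op_S_transform[of 1 LX]
  show "(\<lambda>p. poly p 1) \<in> G1" "S_transform (\<lambda>p. poly p 1) = 1" by simp_all
qed

definition series_group :: "complex fps monoid" where
  "series_group = \<lparr>carrier = {f. fps_nth f 0 = 1}, monoid.mult = (*), one = 1\<rparr>"

lemma series_group: "group series_group"
proof (rule groupI)
  fix f assume "f \<in> carrier series_group"
  then have "inverse f \<in> carrier series_group" "inverse f \<otimes>\<^bsub>series_group\<^esub> f = \<one>\<^bsub>series_group\<^esub>"
    by (simp_all add: series_group_def inverse_mult_eq_1)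
  then show "\<exists>g\<in>carrier series_group. g \<otimes>\<^bsub>series_group\<^esub> f = \<one>\<^bsub>series_group\<^esub>" by blast
qed (simp_all add: series_group_def mult.assoc)

lemma S_transform_iso: "S_transform \<in> iso G1_group series_group"
proof (rule isoI)
  show "S_transform \<in> hom G1_group series_group"
    by (rule homI) (simp_all add: G1_group_def series_group_def S_transform_0 S_transform_free_mult_conv)
  have "S_transform ` G1 = {f. fps_nth f 0 = 1}"
    using haagerup_op_S_transform[of _ LX] by (force simp: S_transform_0 image_iff)
  then show "bij_betw S_transform (carrier G1_group) (carrier series_group)"
    by (simp add: bij_betw_def S_transform_inj G1_group_def series_group_def)
qed


section \<open>Characters as power series\<close>

text \<open>The signs are those in the definition of \<open>\<theta>\<^sub>\<mu>\<close>, so that the series of \<open>\<theta>\<^sub>\<mu>\<close> is \<open>S\<^sub>\<mu>\<close>.\<close>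

definition char_series :: "(sym \<Rightarrow> complex) \<Rightarrow> complex fps" where
  "char_series \<xi> = Abs_fps (\<lambda>n. (-1) ^ n * \<xi> (sym_h n))"

text \<open>The character with \<open>h\<^sub>n \<mapsto> c n\<close> for \<open>n \<ge> 1\<close>; the index shift is due to the entry at \<open>i\<close> of an
  exponent vector being the exponent of \<open>h\<^sub>i\<^sub>+\<^sub>1\<close>.\<close>

definition char_with_values :: "(nat \<Rightarrow> complex) \<Rightarrow> sym \<Rightarrow> complex" where
  "char_with_values c = lin_ext (*) (\<lambda>m. \<Prod>i\<in>Poly_Mapping.keys m. c (Suc i) ^ Poly_Mapping.lookup m i)"

lemma complex_algebra_complex: "complex_algebra ((*) :: complex \<Rightarrow> complex \<Rightarrow> complex)"
  by (intro complex_algebra.intro vector_space_complex complex_algebra_axioms.intro) simp_all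

lemma char_with_values: "char_with_values c \<in> sym_characters"
proof -
  have "char_with_values c (f * g) = char_with_values c f * char_with_values c g" for f g
    unfolding char_with_values_def
  proof (rule lin_ext_mult[OF complex_algebra_complex])
    fix m n :: sym_monom
    let ?K = "Poly_Mapping.keys m \<union> Poly_Mapping.keys n"
    have ext: "(\<Prod>i\<in>Poly_Mapping.keys k. c (Suc i) ^ Poly_Mapping.lookup k i) =
        (\<Prod>i\<in>?K. c (Suc i) ^ Poly_Mapping.lookup k i)" if "Poly_Mapping.keys k \<subseteq> ?K" for k
      using that by (intro prod.mono_neutral_left) (auto simp: in_keys_iff)
    show "(\<Prod>i\<in>Poly_Mapping.keys (m + n). c (Suc i) ^ Poly_Mapping.lookup (m + n) i) =
        (\<Prod>i\<in>Poly_Mapping.keys m. c (Suc i) ^ Poly_Mapping.lookup m i) *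
        (\<Prod>i\<in>Poly_Mapping.keys n. c (Suc i) ^ Poly_Mapping.lookup n i)"
      unfolding ext[of m, OF Un_upper1] ext[of n, OF Un_upper2] ext[OF Poly_Mapping.keys_add]
      by (simp add: lookup_add power_add prod.distrib)
  qed
  moreover have "char_with_values c 1 = 1"
    unfolding char_with_values_def by (subst single_one[symmetric], subst lin_ext_single[OF vector_space_complex]) simp
  ultimately show ?thesis
    by (simp add: sym_characters_def char_with_values_def linear_lin_ext vector_space_complex)
qed

lemma char_with_values_h: "n \<ge> 1 \<Longrightarrow> char_with_values c (sym_h n) = c n"
  by (cases n) (simp_all add: char_with_values_def lin_ext_single[OF vector_space_complex])

lemma single_add_eq_mult:
  "Poly_Mapping.single (m + n) (1::complex) = Poly_Mapping.single m 1 * Poly_Mapping.single n 1"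
  by (simp add: mult_single)

lemma monomial_eq_prod_h:
  "Poly_Mapping.single m 1 = (\<Prod>i\<in>Poly_Mapping.keys m. sym_h (Suc i) ^ Poly_Mapping.lookup m i)"
proof -
  have power: "Poly_Mapping.single (Poly_Mapping.single i k) 1 = sym_h (Suc i) ^ k" for i k
  proof (induction k)
    case (Suc k)
    have "Poly_Mapping.single (Poly_Mapping.single i (Suc k)) (1 :: complex) =
        Poly_Mapping.single (Poly_Mapping.single i 1) 1 * Poly_Mapping.single (Poly_Mapping.single i k) 1"
      by (simp add: mult_single flip: single_add)
    then show ?case by (simp add: Suc)
  qed simp
  have prod: "Poly_Mapping.single (\<Sum>i\<in>K. x i) (1::complex) = (\<Prod>i\<in>K. Poly_Mapping.single (x i) 1)"
    for K and x :: "nat \<Rightarrow> sym_monom"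
    by (induction K rule: infinite_finite_induct) (simp_all add: single_add_eq_mult)
  have "m = (\<Sum>i\<in>Poly_Mapping.keys m. Poly_Mapping.single i (Poly_Mapping.lookup m i))"
    by (rule poly_mapping_eqI) (auto simp: lookup_sum lookup_single when_def sum.delta in_keys_iff)
  then have "Poly_Mapping.single m (1::complex) =
      Poly_Mapping.single (\<Sum>i\<in>Poly_Mapping.keys m. Poly_Mapping.single i (Poly_Mapping.lookup m i)) 1"
    by simp
  then show ?thesis by (simp only: prod power)
qed

lemma sym_characters_eqI:
  assumes "\<xi> \<in> sym_characters" "\<eta> \<in> sym_characters"
    and h: "\<And>n. n \<ge> 1 \<Longrightarrow> \<xi> (sym_h n) = \<eta> (sym_h n)"
  shows "\<xi> = \<eta>"
proof
  fix f
  have mono: "\<zeta> (Poly_Mapping.single m 1) = (\<Prod>i\<in>Poly_Mapping.keys m. \<zeta> (sym_h (Suc i)) ^ Poly_Mapping.lookup m i)"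
    if "\<zeta> \<in> sym_characters" for \<zeta> m
  proof -
    have one: "\<zeta> 1 = 1" and mult: "\<zeta> (f * g) = \<zeta> f * \<zeta> g" for f g
      using that by (auto simp: sym_characters_def)
    have power: "\<zeta> (f ^ k) = \<zeta> f ^ k" for f k
      by (induction k) (simp_all add: one mult)
    have "\<zeta> (\<Prod>i\<in>K. x i) = (\<Prod>i\<in>K. \<zeta> (x i))" for K and x :: "nat \<Rightarrow> sym"
      by (induction K rule: infinite_finite_induct) (simp_all add: one mult)
    then show ?thesis by (simp only: monomial_eq_prod_h power)
  qed
  interpret X: Vector_Spaces.linear pm_scale "(*)" \<xi> using assms(1) by (simp add: sym_characters_def)
  interpret Y: Vector_Spaces.linear pm_scale "(*)" \<eta> using assms(2) by (simp add: sym_characters_def)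
  have "\<xi> (Poly_Mapping.single m 1) = \<eta> (Poly_Mapping.single m 1)" for m
    unfolding mono[OF assms(1)] mono[OF assms(2)] using h by (simp del: sym_h.simps)
  then show "\<xi> f = \<eta> f"
    by (subst (1 2) pm_expand[of f]) (simp only: X.sum Y.sum X.scale Y.scale)
qed

lemma sym_convolution_character:
  assumes "\<xi> \<in> sym_characters" "\<eta> \<in> sym_characters"
  shows "sym_convolution \<xi> \<eta> \<in> sym_characters"
proof -
  let ?B = "\<lambda>(m, n). \<xi> (Poly_Mapping.single m 1) * \<eta> (Poly_Mapping.single n 1)"
  have one: "\<xi> 1 = 1" "\<eta> 1 = 1" and mult: "\<xi> (f * g) = \<xi> f * \<xi> g" "\<eta> (f * g) = \<eta> f * \<eta> g" for f g
    using assms by (auto simp: sym_characters_def)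
  have "?B (p + q) = ?B p * ?B q" for p q
    by (cases p; cases q) (simp add: single_add_eq_mult mult)
  then have "tensor_functional \<xi> \<eta> (f * g) = tensor_functional \<xi> \<eta> f * tensor_functional \<xi> \<eta> g" for f g
    unfolding tensor_functional_def by (rule lin_ext_mult[OF complex_algebra_complex])
  moreover have "tensor_functional \<xi> \<eta> 1 = 1"
    unfolding tensor_functional_def
    by (subst single_one[symmetric], subst lin_ext_single[OF vector_space_complex])
       (simp add: zero_prod_def one)
  moreover have "Vector_Spaces.linear pm_scale (*) (sym_convolution \<xi> \<eta>)"
    unfolding sym_convolution_def
  proof (rule Vector_Spaces.linear_compose[OF sym_comult_linear])
    show "Vector_Spaces.linear pm_scale (*) (tensor_functional \<xi> \<eta>)"
      unfolding tensor_functional_def by (rule linear_lin_ext[OF vector_space_complex])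
  qed
  ultimately show ?thesis
    by (simp add: sym_characters_def sym_convolution_def sym_comult_mult sym_comult_one)
qed

lemma sym_convolution_h:
  assumes "\<xi> \<in> sym_characters" "\<eta> \<in> sym_characters"
  shows "sym_convolution \<xi> \<eta> (sym_h n) = (\<Sum>i\<le>n. \<xi> (sym_h i) * \<eta> (sym_h (n - i)))"
proof -
  interpret T: Vector_Spaces.linear pm_scale "(*)" "tensor_functional \<xi> \<eta>"
    unfolding tensor_functional_def by (rule linear_lin_ext[OF vector_space_complex])
  show ?thesis
    using assms by (simp add: sym_convolution_def sym_comult_h T.sum tensor_functional_tensor sym_characters_def)
qed

lemma char_series_convolution:
  assumes "\<xi> \<in> sym_characters" "\<eta> \<in> sym_characters"
  shows "char_series (sym_convolution \<xi> \<eta>) = char_series \<xi> * char_series \<eta>"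
proof (rule fps_ext)
  fix n
  have "(-1) ^ n * (\<Sum>i\<le>n. \<xi> (sym_h i) * \<eta> (sym_h (n - i))) =
      (\<Sum>i\<le>n. ((-1) ^ i * \<xi> (sym_h i)) * ((-1) ^ (n - i) * \<eta> (sym_h (n - i))))"
    unfolding sum_distrib_left
  proof (rule sum.cong[OF refl])
    fix i assume "i \<in> {..n}"
    then have "(-1 :: complex) ^ n = (-1) ^ i * (-1) ^ (n - i)" by (simp flip: power_add)
    moreover have "p = q * r \<Longrightarrow> p * (x * y) = (q * x) * (r * y)" for p q r x y :: complex
      by simp
    ultimately show "(-1) ^ n * (\<xi> (sym_h i) * \<eta> (sym_h (n - i))) =
        ((-1) ^ i * \<xi> (sym_h i)) * ((-1) ^ (n - i) * \<eta> (sym_h (n - i)))"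
      by blast
  qed
  then show "fps_nth (char_series (sym_convolution \<xi> \<eta>)) n = fps_nth (char_series \<xi> * char_series \<eta>) n"
    by (simp only: char_series_def fps_nth_Abs_fps fps_mult_nth sym_convolution_h[OF assms] atLeast0AtMost)
qed

text \<open>The counit is the character that vanishes at every \<open>h\<^sub>n\<close> with \<open>n \<ge> 1\<close>.\<close>

lemma sym_counit_character: "sym_counit \<in> sym_characters"
proof -
  have "(\<Prod>i\<in>Poly_Mapping.keys m. 0 ^ Poly_Mapping.lookup m i) = (if m = 0 then 1 else (0::complex))"
    for m :: sym_monom
    by (auto simp: in_keys_iff power_0_left)
  then have "char_with_values (\<lambda>_. 0) f = (\<Sum>m\<in>Poly_Mapping.keys f. if m = 0 then Poly_Mapping.lookup f m else 0)"
    for f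
    unfolding char_with_values_def lin_ext_def by (intro sum.cong) simp_all
  then have "char_with_values (\<lambda>_. 0) = sym_counit"
    by (simp add: fun_eq_iff sym_counit_def in_keys_iff)
  then show ?thesis using char_with_values by metis
qed

lemma char_series_counit: "char_series sym_counit = 1"
proof (rule fps_ext)
  have "Poly_Mapping.single i (Suc 0) \<noteq> 0" for i :: nat
    by (metis lookup_single_eq lookup_zero nat.distinct(1))
  then show "fps_nth (char_series sym_counit) n = fps_nth 1 n" for n
    by (cases n) (simp_all add: char_series_def sym_counit_def lookup_single lookup_one when_def)
qed

lemma minus_one_power_mult_self: "(-1) ^ n * ((-1) ^ n * z) = (z :: complex)"
  by (cases "even n") simp_all

lemma char_series_iso: "char_series \<in> iso sym_character_group series_group"
proof (rule isoI)
  have zero: "fps_nth (char_series \<xi>) 0 = 1" if "\<xi> \<in> sym_characters" for \<xi>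
    using that by (simp add: char_series_def sym_characters_def)
  then show "char_series \<in> hom sym_character_group series_group"
    by (intro homI) (simp_all add: sym_character_group_def series_group_def char_series_convolution)
  have inj: "inj_on char_series sym_characters"
  proof (rule inj_onI)
    fix \<xi> \<eta> assume *: "\<xi> \<in> sym_characters" "\<eta> \<in> sym_characters" "char_series \<xi> = char_series \<eta>"
    have "\<xi> (sym_h n) = \<eta> (sym_h n)" for n
      using arg_cong[OF *(3), of "\<lambda>f. fps_nth f n"] by (simp add: char_series_def)
    with * show "\<xi> = \<eta>" by (intro sym_characters_eqI)
  qed
  have surj: "f \<in> char_series ` sym_characters" if "fps_nth f 0 = 1" for f
  proof
    show "char_with_values (\<lambda>n. (-1) ^ n * fps_nth f n) \<in> sym_characters"
      by (rule char_with_values)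
    let ?\<xi> = "char_with_values (\<lambda>n. (-1) ^ n * fps_nth f n)"
    have "fps_nth (char_series ?\<xi>) n = fps_nth f n" for n
    proof (cases "n = 0")
      case True
      then show ?thesis using zero[OF char_with_values] that by simp
    next
      case False
      then show ?thesis
        by (simp add: char_series_def char_with_values_h minus_one_power_mult_self)
    qed
    then show "f = char_series ?\<xi>" by (metis fps_ext)
  qed
  have "char_series ` sym_characters = {f. fps_nth f 0 = 1}"
    using zero surj by blast
  then show "bij_betw char_series (carrier sym_character_group) (carrier series_group)"
    by (simp add: bij_betw_def inj sym_character_group_def series_group_def)
qed


section \<open>The isomorphism from distributions to characters\<close>

text \<open>Here \<open>G\<close> is a mere structure, not known to be a monoid; associativity, unit and inverses are
  pulled back along the injection \<open>h\<close>.\<close>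

lemma group_from_iso:
  assumes "group H" "h \<in> iso G H"
    and closed: "\<And>x y. x \<in> carrier G \<Longrightarrow> y \<in> carrier G \<Longrightarrow> x \<otimes>\<^bsub>G\<^esub> y \<in> carrier G"
    and one: "\<one>\<^bsub>G\<^esub> \<in> carrier G" "h \<one>\<^bsub>G\<^esub> = \<one>\<^bsub>H\<^esub>"
  shows "group G"
proof -
  interpret H: group H by fact
  have mult: "h (x \<otimes>\<^bsub>G\<^esub> y) = h x \<otimes>\<^bsub>H\<^esub> h y" if "x \<in> carrier G" "y \<in> carrier G" for x y
    using assms(2) that by (simp add: iso_def hom_def)
  have inj: "inj_on h (carrier G)" and img: "h ` carrier G = carrier H"
    using assms(2) by (auto simp: iso_def bij_betw_def)
  have car: "h x \<in> carrier H" if "x \<in> carrier G" for x using img that by blast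
  show ?thesis
  proof (rule groupI)
    fix x y z assume "x \<in> carrier G" "y \<in> carrier G" "z \<in> carrier G"
    then show "x \<otimes>\<^bsub>G\<^esub> y \<otimes>\<^bsub>G\<^esub> z = x \<otimes>\<^bsub>G\<^esub> (y \<otimes>\<^bsub>G\<^esub> z)"
      by (intro inj_onD[OF inj]) (simp_all add: closed mult car H.m_assoc)
  next
    fix x assume x: "x \<in> carrier G"
    then show "\<one>\<^bsub>G\<^esub> \<otimes>\<^bsub>G\<^esub> x = x"
      by (intro inj_onD[OF inj]) (simp_all add: closed mult car one)
    obtain y where "y \<in> carrier G" "h y = inv\<^bsub>H\<^esub> (h x)"
      using img car[OF x] by (metis H.inv_closed imageE)
    then show "\<exists>y\<in>carrier G. y \<otimes>\<^bsub>G\<^esub> x = \<one>\<^bsub>G\<^esub>"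
      using x by (intro bexI[of _ y] inj_onD[OF inj]) (simp_all add: closed mult car one)
  qed (simp_all add: closed one)
qed

lemma theta_ex1:
  assumes "\<mu> \<in> G1"
  shows "\<exists>!\<theta>. \<theta> \<in> sym_characters \<and> (\<forall>n\<ge>1. \<theta> (sym_h n) = (-1) ^ n * fps_nth (S_transform \<mu>) n)"
proof (rule ex1I)
  show "char_with_values (\<lambda>n. (-1) ^ n * fps_nth (S_transform \<mu>) n) \<in> sym_characters \<and>
      (\<forall>n\<ge>1. char_with_values (\<lambda>n. (-1) ^ n * fps_nth (S_transform \<mu>) n) (sym_h n) =
        (-1) ^ n * fps_nth (S_transform \<mu>) n)"
    by (simp add: char_with_values char_with_values_h)
qed (auto intro!: sym_characters_eqI simp: char_with_values char_with_values_h)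

lemma char_series_theta:
  assumes "\<mu> \<in> G1"
  shows "theta \<mu> \<in> sym_characters" "char_series (theta \<mu>) = S_transform \<mu>"
proof -
  have \<theta>: "theta \<mu> \<in> sym_characters \<and>
      (\<forall>n\<ge>1. theta \<mu> (sym_h n) = (-1) ^ n * fps_nth (S_transform \<mu>) n)"
    unfolding theta_def by (rule theI'[OF theta_ex1[OF assms]])
  then show "theta \<mu> \<in> sym_characters" ..
  have "fps_nth (char_series (theta \<mu>)) n = fps_nth (S_transform \<mu>) n" for n
  proof (cases "n = 0")
    case True
    then show ?thesis
      using \<theta> S_transform_0[OF assms] by (simp add: char_series_def sym_characters_def)
  next
    case False
    then show ?thesis using \<theta> by (simp add: char_series_def minus_one_power_mult_self)
  qed
  then show "char_series (theta \<mu>) = S_transform \<mu>" by (rule fps_ext)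
qed

theorem proposition6p5:
  shows "(\<forall>\<mu>\<in>G1. \<exists>!\<theta>. \<theta> \<in> sym_characters \<and>
            (\<forall>n\<ge>1. \<theta> (sym_h n) = (-1) ^ n * fps_nth (S_transform \<mu>) n)) \<and>
         group G1_group \<and> group sym_character_group \<and>
         theta \<in> iso G1_group sym_character_group"
proof (intro conjI ballI theta_ex1)
  show G: "group G1_group"
    by (rule group_from_iso[OF series_group S_transform_iso])
       (simp_all add: G1_group_def series_group_def S_transform_free_mult_conv S_transform_one)
  show C: "group sym_character_group"
    by (rule group_from_iso[OF series_group char_series_iso])
       (simp_all add: sym_character_group_def series_group_def sym_convolution_character
          sym_counit_character char_series_counit)
  \<comment> \<open>On \<open>G1\<close>, \<open>theta\<close> is the S-transform followed by the inverse of \<open>char_series\<close>.\<close>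
  let ?inv = "inv_into (carrier sym_character_group) char_series"
  have inj: "inj_on char_series sym_characters"
    using char_series_iso by (simp add: iso_def bij_betw_def sym_character_group_def)
  have "?inv \<circ> S_transform \<in> iso G1_group sym_character_group"
    using S_transform_iso group.iso_set_sym[OF C char_series_iso] by (rule iso_set_trans)
  moreover have "theta \<mu> = (?inv \<circ> S_transform) \<mu>" if "\<mu> \<in> carrier G1_group" for \<mu>
    using that char_series_theta[of \<mu>] inv_into_f_f[OF inj, of "theta \<mu>"]
    by (simp add: G1_group_def sym_character_group_def)
  ultimately show "theta \<in> iso G1_group sym_character_group"
    using group.iso_eq[OF G] by blast
qed

end
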